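(* Every non-separable convex subset of a Fréchet space has the locally finite approximation property (LFAP).
   Context: A Fréchet space is a locally convex complete linear metric space, where a linear metric space is a topological vector space whose topology is generated by a translation-invariant metric. A topological space $X$ has the locally finite approximation property (LFAP) if for each open cover $\mathcal U$ of $X$ there is a sequence of continuous maps $f_n:X\to X$, $n\in\omega$, such that each $f_n$ is $\mathcal U$-near to the identity $\mathrm{id}_X$ (i.e. for every $x\in X$ there is $U\in\mathcal U$ containing both $x$ and $f_n(x)$) and the family $(f_n(X))_{n\in\omega}$ is locally finite in $X$ (each point of $X$ has a neighborhood meeting only finitely many of the sets $f_n(X)$). *)

theory Defs
  imports "HOL-Analysis.Analysis"
begin

definition frechet_metric :: "('a::real_vector \<Rightarrow> 'a \<Rightarrow> real) \<Rightarrow> bool" where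
  "frechet_metric d \<longleftrightarrow>
     Metric_space UNIV d \<and>
     (\<forall>x y z. d (x + z) (y + z) = d x y) \<and>
     continuous_map (prod_topology (Metric_space.mtopology UNIV d) (Metric_space.mtopology UNIV d))
        (Metric_space.mtopology UNIV d) (\<lambda>(x, y). x + y) \<and>
     continuous_map (prod_topology euclideanreal (Metric_space.mtopology UNIV d))
        (Metric_space.mtopology UNIV d) (\<lambda>(a, x). a *\<^sub>R x) \<and>
     (\<forall>U. openin (Metric_space.mtopology UNIV d) U \<and> 0 \<in> U \<longrightarrow>
        (\<exists>V. openin (Metric_space.mtopology UNIV d) V \<and> 0 \<in> V \<and> convex V \<and> V \<subseteq> U)) \<and>
     Metric_space.mcomplete UNIV d"

definition LFAP :: "'a topology \<Rightarrow> bool" where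
  "LFAP X \<longleftrightarrow>
     (\<forall>\<U>. (\<forall>U\<in>\<U>. openin X U) \<and> \<Union>\<U> = topspace X \<longrightarrow>
        (\<exists>f :: nat \<Rightarrow> 'a \<Rightarrow> 'a.
           (\<forall>n. continuous_map X X (f n)) \<and>
           (\<forall>n. \<forall>x\<in>topspace X. \<exists>U\<in>\<U>. x \<in> U \<and> f n x \<in> U) \<and>
           (\<forall>x\<in>topspace X. \<exists>V. openin X V \<and> x \<in> V \<and>
               finite {n. f n ` topspace X \<inter> V \<noteq> {}})))"

end

theory Submission
  imports Defs
begin

text \<open>
  Write \<open>|x| = d x 0\<close>. A non-separable convex set \<open>C\<close> contains points \<open>b + e n\<close> where the
  sequence \<open>e\<close> is bounded, yet every \<open>e n\<close> keeps distance at least 1, in some continuous seminorm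
  \<open>p\<close>, from the span of its predecessors. Let \<open>K\<close> be the polygonal path through the \<open>e n\<close> and put
  \<open>f n x = (1 - \<delta> x) x + \<delta> x (b + K (max n (m x)))\<close> with continuous functions \<open>\<delta>\<close> and \<open>m\<close>. Boundedness of \<open>e\<close> makes \<open>f n\<close> as close to the identity
  as desired if \<open>\<delta>\<close> is small. For local finiteness let \<open>N\<close> be the closed span of \<open>e\<close>. By the
  Bartle--Graves theorem there is a continuous map \<open>r\<close> onto \<open>N\<close> that commutes with translations by
  elements of \<open>N\<close>, so \<open>r (f n x)\<close> is the sum of \<open>u x = r ((1 - \<delta> x) x + \<delta> x b)\<close>, an element of
  \<open>N\<close>, and \<open>\<delta> x K (max n (m x))\<close>. Choosing \<open>m\<close> so large that \<open>u x\<close> is, relative to \<open>\<delta> x\<close>, close to the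
  span of the first \<open>m x\<close> vectors, we see that \<open>r (f n x)\<close> stays away from the span of the first \<open>n\<close>
  vectors by a fixed multiple of \<open>\<delta> x\<close>. As these spans fill up \<open>N\<close>, a limit point \<open>w\<close> of
  \<open>f n (x n)\<close> would force \<open>\<delta> (x n)\<close> to tend to zero; then \<open>x n\<close> itself tends to \<open>w\<close>,
  contradicting \<open>\<delta> w > 0\<close>.
\<close>

section \<open>Partitions of unity for uniform covers\<close>

text \<open>Along a well-order, the increments of the running supremum of a family \<open>\<phi>\<close> add up to its
  supremum, no increment being lost at limit stages. Applied to bump functions with supremum 1 this
  gives a partition of unity with infinite sums, made locally finite by a trick of Mather:
  discard the part of each function below half of the largest one.\<close>

lemma record_sum_le:
  fixes \<phi> M :: "'b \<Rightarrow> real"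
  assumes r: "well_order_on UNIV r"
    and M: "\<And>y z. (z, y) \<in> r \<Longrightarrow> z \<noteq> y \<Longrightarrow> \<phi> z \<le> M y" and M0: "\<And>y. 0 \<le> M y"
    and G: "finite G" and m: "0 \<le> m" "\<And>z. z \<in> G \<Longrightarrow> \<phi> z \<le> m"
  shows "(\<Sum>y\<in>G. max 0 (\<phi> y - M y)) \<le> m"
proof -
  have lin: "linear_order_on UNIV r"
    using r by (simp add: well_order_on_def)
  have rf: "(x, x) \<in> r" and tr: "(x, y) \<in> r \<Longrightarrow> (y, z) \<in> r \<Longrightarrow> (x, z) \<in> r"
    and as: "(x, y) \<in> r \<Longrightarrow> (y, x) \<in> r \<Longrightarrow> x = y" and tot: "x = y \<or> (x, y) \<in> r \<or> (y, x) \<in> r"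
    for x y z
    using lin unfolding linear_order_on_def partial_order_on_def preorder_on_def refl_on_def
      total_on_def trans_def antisym_def by blast+
  \<comment> \<open>Viewing \<open>r\<close> as a linear order allows induction on finite sets in
    which each new element is the largest so far.\<close>
  interpret L: linorder "\<lambda>x y. (x, y) \<in> r" "\<lambda>x y. (x, y) \<in> r \<and> x \<noteq> y"
  proof
    show "(x, y) \<in> r \<and> x \<noteq> y \<longleftrightarrow> (x, y) \<in> r \<and> (y, x) \<notin> r" for x y
      using as rf by blast
    show "(x, y) \<in> r \<or> (y, x) \<in> r" for x y
      using tot[of x y] rf by blast
  qed (use rf tr as in blast)+
  show ?thesis
    using G m
  proof (induction G arbitrary: m rule: L.finite_linorder_max_induct)
    case empty
    then show ?case by simp
  next
    case (insert y G)
    \<comment> \<open>All of \<open>G\<close> precedes \<open>y\<close>, so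
      \<open>m' \<le> M y\<close>. The increments over \<open>G\<close> sum to at most
      \<open>m'\<close>, and the one at \<open>y\<close> adds at most \<open>m - m'\<close>.\<close>
    define m' where "m' = Max (insert 0 (\<phi> ` G))"
    have "(\<Sum>z\<in>G. max 0 (\<phi> z - M z)) \<le> m'"
      using insert.hyps by (intro insert.IH) (auto simp: m'_def)
    moreover have "m' \<le> m" "m' \<le> M y"
      using insert M M0 by (auto simp: m'_def)
    moreover have "y \<notin> G"
      using insert.hyps by blast
    moreover have "\<phi> y \<le> m"
      using insert.prems by blast
    then have "max 0 (\<phi> y - M y) \<le> m - m'"
      using calculation by linarith
    ultimately show ?case
      using insert.hyps by simp
  qed
qed

text \<open>Transfinite induction on \<open>y\<close>: a value below \<open>M y\<close> is exceeded
  by \<open>\<phi> z\<close> for some \<open>z\<close> strictly before \<open>y\<close>, hence by a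
  finite sum of increments before \<open>y\<close>. The increment at \<open>y\<close> makes up the
  rest.\<close>

lemma record_sum_ge:
  fixes \<phi> M :: "'b \<Rightarrow> real"
  assumes r: "well_order_on UNIV r"
    and M: "\<And>y c. 0 \<le> c \<Longrightarrow> c < M y \<Longrightarrow> \<exists>z. (z, y) \<in> r \<and> z \<noteq> y \<and> c < \<phi> z"
    and c: "c < \<phi> y" "0 \<le> c"
  shows "\<exists>G. finite G \<and> c < (\<Sum>y\<in>G. max 0 (\<phi> y - M y))"
proof -
  have lin: "linear_order_on UNIV r" and wf: "wf (r - Id)"
    using r by (simp_all add: well_order_on_def)
  have tr: "trans (r - Id)"
    using lin by (simp add: linear_order_on_def partial_order_on_def preorder_on_def trans_diff_Id)
  have "\<forall>c. 0 \<le> c \<longrightarrow> c < \<phi> y \<longrightarrow> (\<exists>G. finite G \<and> G \<subseteq> {z. (z, y) \<in> r} \<and> c < (\<Sum>y\<in>G. max 0 (\<phi> y - M y)))"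
  proof (induction y rule: wf_induct_rule[OF wf])
    case (1 y)
    show ?case
    proof (intro allI impI)
      fix c assume c: "0 \<le> c" "c < \<phi> y"
      have yy: "(y, y) \<in> r"
        using lin by (simp add: linear_order_on_def partial_order_on_def preorder_on_def refl_on_def)
      have step: "\<exists>G. finite G \<and> G \<subseteq> {z. (z, y) \<in> r} - {y} \<and> c' < (\<Sum>y\<in>G. max 0 (\<phi> y - M y))"
        if c': "0 \<le> c'" "c' < M y" for c'
      proof -
        obtain z where z: "(z, y) \<in> r" "z \<noteq> y" "c' < \<phi> z"
          using M[OF c'] by blast
        then obtain G where G: "finite G" "G \<subseteq> {w. (w, z) \<in> r}" "c' < (\<Sum>y\<in>G. max 0 (\<phi> y - M y))"
          using 1[of z] c' by blast
        have "(w, y) \<in> r \<and> w \<noteq> y" if "(w, z) \<in> r" for w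
        proof (cases "w = z")
          case False
          then have "(w, y) \<in> r - Id"
            using tr that z by (intro transD[OF tr, of w z y]) auto
          then show ?thesis by auto
        qed (use z in auto)
        then show ?thesis
          using G by (intro exI[of _ G]) auto
      qed
      show "\<exists>G. finite G \<and> G \<subseteq> {z. (z, y) \<in> r} \<and> c < (\<Sum>y\<in>G. max 0 (\<phi> y - M y))"
      proof (cases "c < M y")
        case True
        then show ?thesis using step[of c] c by blast
      next
        case False
        show ?thesis
        proof (cases "M y \<le> 0")
          case True
          then show ?thesis
            using c yy by (intro exI[of _ "{y}"]) auto
        next
          case Mp: False
          \<comment> \<open>Here \<open>M y \<le> c < \<phi> y\<close>. Staying within half of
            \<open>\<phi> y - c\<close> below \<open>M y\<close> suffices: adding the increment
            \<open>\<phi> y - M y\<close> gives at least the midpoint of \<open>c\<close> and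
            \<open>\<phi> y\<close>.\<close>
          define c' where "c' = max 0 (M y - (\<phi> y - c) / 2)"
          have "0 \<le> c'" "c' < M y"
            using c Mp by (auto simp: c'_def)
          then obtain G where G: "finite G" "G \<subseteq> {z. (z, y) \<in> r} - {y}"
              "c' < (\<Sum>y\<in>G. max 0 (\<phi> y - M y))"
            using step by blast
          have "(\<Sum>y\<in>insert y G. max 0 (\<phi> y - M y)) = max 0 (\<phi> y - M y) + (\<Sum>y\<in>G. max 0 (\<phi> y - M y))"
            using G by (subst sum.insert) auto
          then have "c < (\<Sum>y\<in>insert y G. max 0 (\<phi> y - M y))"
            using G(3) c by (simp add: c'_def max_def field_simps split: if_splits)
          then show ?thesis
            using G yy by (intro exI[of _ "insert y G"]) auto
        qed
      qed
    qed
  qed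
  then show ?thesis using c by blast
qed

lemma cSUP_diff_le:
  fixes f g :: "'b \<Rightarrow> real"
  assumes "A \<noteq> {}" "bdd_above (f ` A)" "bdd_above (g ` A)" "\<And>y. y \<in> A \<Longrightarrow> \<bar>f y - g y\<bar> \<le> e"
  shows "\<bar>(SUP y\<in>A. f y) - (SUP y\<in>A. g y)\<bar> \<le> e"
proof -
  have "(SUP y\<in>A. f y) \<le> (SUP y\<in>A. g y) + e"
  proof (rule cSUP_least[OF assms(1)])
    fix y assume y: "y \<in> A"
    have "g y \<le> (SUP y\<in>A. g y)"
      by (rule cSUP_upper[OF y assms(3)])
    then show "f y \<le> (SUP y\<in>A. g y) + e"
      using assms(4)[OF y] by linarith
  qed
  moreover have "(SUP y\<in>A. g y) \<le> (SUP y\<in>A. f y) + e"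
  proof (rule cSUP_least[OF assms(1)])
    fix y assume y: "y \<in> A"
    have "f y \<le> (SUP y\<in>A. f y)"
      by (rule cSUP_upper[OF y assms(2)])
    then show "g y \<le> (SUP y\<in>A. f y) + e"
      using assms(4)[OF y] by linarith
  qed
  ultimately show ?thesis by linarith
qed

section \<open>Locally finite partitions of unity for a pseudometric\<close>

lemma uniform_partition_of_unity:
  fixes D :: "'b \<Rightarrow> 'b \<Rightarrow> real"
  assumes D0: "\<And>x. D x x = 0" and Dnn: "\<And>x y. 0 \<le> D x y" and Dsym: "\<And>x y. D x y = D y x"
    and Dtri: "\<And>x y z. D x z \<le> D x y + D y z" and \<eta>: "\<eta> > 0"
  obtains w :: "'b \<Rightarrow> 'b \<Rightarrow> real"
  where "\<And>y x. 0 \<le> w y x" "\<And>y x. 0 < w y x \<Longrightarrow> D x y < \<eta>"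
    "\<And>z. \<exists>\<rho>>0. \<exists>G. finite G \<and> (\<forall>x. D x z < \<rho> \<longrightarrow> (\<forall>y. y \<notin> G \<longrightarrow> w y x = 0) \<and> (\<Sum>y\<in>G. w y x) = 1)"
    "\<And>y X z. (\<lambda>k. D (X k) z) \<longlonglongrightarrow> 0 \<Longrightarrow> (\<lambda>k. w y (X k)) \<longlonglongrightarrow> w y z"
proof -
  obtain r :: "('b \<times> 'b) set" where r: "well_order_on UNIV r"
    using well_order_on by blast
  \<comment> \<open>The bump of index \<open>x\<close> has value 1 at \<open>x\<close>, so the
    supremum over all indices is 1 everywhere.\<close>
  define \<phi> where "\<phi> y x = max 0 (1 - D x y / \<eta>)" for y x
  define B where "B y = {z. (z, y) \<in> r \<and> z \<noteq> y}" for y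
  \<comment> \<open>The default 0 keeps the family nonempty and the supremum nonnegative, also for
    the least element, which has no predecessors.\<close>
  define M where "M y x = (SUP v. if v \<in> B y then \<phi> v x else 0)" for y x
  define L0 where "L0 y x = max 0 (\<phi> y x - M y x)" for y x
  define \<mu> where "\<mu> x = (SUP y. L0 y x)" for x
  define L1 where "L1 y x = max 0 (L0 y x - \<mu> x / 2)" for y x
  have max0: "\<bar>max 0 a - max 0 b\<bar> \<le> \<bar>a - b\<bar>" for a b :: real
    by (simp add: max_def)
  have Ddiff: "\<bar>D x y - D x' y\<bar> \<le> D x x'" for x x' y
    using Dtri[of x y x'] Dtri[of x' y x] Dsym[of x x'] by linarith
  have \<phi>01: "0 \<le> \<phi> y x" "\<phi> y x \<le> 1" for y x
    using \<eta> Dnn by (auto simp: \<phi>_def)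
  have \<phi>lip: "\<bar>\<phi> y x - \<phi> y x'\<bar> \<le> D x x' / \<eta>" for y x x'
  proof -
    have "\<bar>D x y / \<eta> - D x' y / \<eta>\<bar> \<le> D x x' / \<eta>"
      using divide_right_mono[OF Ddiff[of x y x'], of \<eta>] \<eta>
      by (simp add: diff_divide_distrib[symmetric] abs_divide)
    moreover have "\<bar>\<phi> y x - \<phi> y x'\<bar> \<le> \<bar>(1 - D x y / \<eta>) - (1 - D x' y / \<eta>)\<bar>"
      unfolding \<phi>_def by (rule max0)
    ultimately show ?thesis by linarith
  qed
  have Mbdd: "bdd_above (range (\<lambda>v. if v \<in> B y then \<phi> v x else 0))" for y x
    using \<phi>01 by (intro bdd_aboveI2[of _ _ 1]) auto
  have Mlip: "\<bar>M y x - M y x'\<bar> \<le> D x x' / \<eta>" for y x x'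
    unfolding M_def
  proof (intro cSUP_diff_le Mbdd UNIV_not_empty)
    fix v
    show "\<bar>(if v \<in> B y then \<phi> v x else 0) - (if v \<in> B y then \<phi> v x' else 0)\<bar> \<le> D x x' / \<eta>"
      using \<phi>lip[of v x x'] Dnn[of x x'] \<eta> by (simp split: if_split)
  qed
  have M0: "0 \<le> M y x" for y x
    using cSUP_upper[OF UNIV_I Mbdd[of y x], of y] by (auto simp: M_def B_def)
  have M1: "\<phi> z x \<le> M y x" if "(z, y) \<in> r" "z \<noteq> y" for z y x
    using cSUP_upper[OF UNIV_I Mbdd[of y x], of z] that by (auto simp: M_def B_def)
  have M2: "\<exists>z. (z, y) \<in> r \<and> z \<noteq> y \<and> c < \<phi> z x" if "0 \<le> c" "c < M y x" for c y x
  proof -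
    have "\<exists>v\<in>UNIV. c < (if v \<in> B y then \<phi> v x else 0)"
      using that(2) unfolding M_def less_cSUP_iff[OF UNIV_not_empty Mbdd] .
    then obtain v where "c < (if v \<in> B y then \<phi> v x else 0)"
      by blast
    then show ?thesis using that by (auto simp: B_def split: if_splits)
  qed
  have L0le: "(\<Sum>y\<in>G. L0 y x) \<le> 1" if "finite G" for G x
    unfolding L0_def using \<phi>01 M0 M1 that
    by (intro record_sum_le[OF r, where \<phi> = "\<lambda>y. \<phi> y x" and M = "\<lambda>y. M y x"]) auto
  have L0ge: "\<exists>G. finite G \<and> c < (\<Sum>y\<in>G. L0 y x)" if "0 \<le> c" "c < 1" for c x
    unfolding L0_def using M2 that
    by (intro record_sum_ge[OF r, where \<phi> = "\<lambda>y. \<phi> y x" and M = "\<lambda>y. M y x" and y = x])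
      (auto simp: \<phi>_def D0)
  have L01: "L0 y x \<le> 1" for y x
    using L0le[of "{y}" x] by simp
  have L0lip: "\<bar>L0 y x - L0 y x'\<bar> \<le> 2 * (D x x' / \<eta>)" for y x x'
  proof -
    have "\<bar>L0 y x - L0 y x'\<bar> \<le> \<bar>(\<phi> y x - M y x) - (\<phi> y x' - M y x')\<bar>"
      unfolding L0_def by (rule max0)
    then show ?thesis
      using \<phi>lip[of y x x'] Mlip[of y x x'] by linarith
  qed
  have \<mu>bdd: "bdd_above (range (\<lambda>y. L0 y x))" for x
    using L01 by (intro bdd_aboveI2[of _ _ 1]) auto
  have \<mu>lip: "\<bar>\<mu> x - \<mu> x'\<bar> \<le> 2 * (D x x' / \<eta>)" for x x'
    unfolding \<mu>_def by (intro cSUP_diff_le \<mu>bdd UNIV_not_empty L0lip)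
  have \<mu>ge: "L0 y x \<le> \<mu> x" for y x
    using cSUP_upper[OF UNIV_I \<mu>bdd[of x], of y] by (simp add: \<mu>_def)
  have \<mu>pos: "0 < \<mu> x" for x
  proof -
    obtain G where G: "finite G" "0 < (\<Sum>y\<in>G. L0 y x)"
      using L0ge[of 0 x] by auto
    then obtain y where "y \<in> G" "0 < L0 y x"
      by (meson leD not_le_imp_less sum_nonpos)
    then show ?thesis using \<mu>ge[of y x] by linarith
  qed
  have L1lip: "\<bar>L1 y x - L1 y x'\<bar> \<le> 3 * (D x x' / \<eta>)" for y x x'
  proof -
    have "\<bar>L1 y x - L1 y x'\<bar> \<le> \<bar>(L0 y x - \<mu> x / 2) - (L0 y x' - \<mu> x' / 2)\<bar>"
      unfolding L1_def by (rule max0)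
    then show ?thesis
      using L0lip[of y x x'] \<mu>lip[of x x'] by linarith
  qed
  have L1nn: "0 \<le> L1 y x" for y x
    by (simp add: L1_def)
  have L1pos: "\<exists>y. 0 < L1 y x" for x
  proof -
    have "\<mu> x / 2 < (SUP y. L0 y x)"
      using \<mu>pos[of x] by (simp add: \<mu>_def)
    then obtain y where "\<mu> x / 2 < L0 y x"
      unfolding less_cSUP_iff[OF UNIV_not_empty \<mu>bdd] by blast
    then show ?thesis by (auto simp: L1_def max_def)
  qed
  \<comment> \<open>At \<open>z\<close> a finite set of indices carries all but
    \<open>\<mu> z / 8\<close> of the total mass 1. Near \<open>z\<close> it loses at most another
    eighth, so every other \<open>L0 y x\<close> is at most \<open>\<mu> z / 4\<close>. This is
    below the cut-off \<open>\<mu> x / 2\<close>, as \<open>\<mu> x\<close> is still at least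
    \<open>7/8\<close> of \<open>\<mu> z\<close>.\<close>
  have locfin: "\<exists>\<rho>>0. \<exists>G. finite G \<and> (\<forall>x. D x z < \<rho> \<longrightarrow> (\<forall>y. y \<notin> G \<longrightarrow> L1 y x = 0))" for z
  proof -
    obtain G where G: "finite G" "1 - \<mu> z / 8 < (\<Sum>y\<in>G. L0 y z)"
    proof (cases "\<mu> z / 8 \<le> 1")
      case True
      then show ?thesis using L0ge[of "1 - \<mu> z / 8" z] \<mu>pos[of z] that by auto
    next
      case False
      then show ?thesis using that[of "{}"] by auto
    qed
    \<comment> \<open>The summand 1 beside \<open>card G\<close> lets the same radius control the
      change of \<open>\<mu>\<close> itself, also when \<open>G\<close> is empty.\<close>
    define \<rho> where "\<rho> = \<eta> * \<mu> z / (16 * (real (card G) + 1))"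
    have "\<rho> > 0"
      using \<eta> \<mu>pos by (simp add: \<rho>_def)
    moreover have "L1 y x = 0" if x: "D x z < \<rho>" and y: "y \<notin> G" for x y
    proof -
      have e: "2 * (D x z / \<eta>) * (real (card G) + 1) \<le> \<mu> z / 8"
      proof -
        have "D x z / \<eta> < \<mu> z / (16 * (real (card G) + 1))"
          using x \<eta> by (simp add: \<rho>_def pos_divide_less_eq) (simp add: mult.commute)
        then have "D x z / \<eta> * (16 * (real (card G) + 1)) < \<mu> z"
          by (subst (asm) pos_less_divide_eq) auto
        then show ?thesis
          by (simp add: algebra_simps add_divide_distrib)
      qed
      have nn: "0 \<le> 2 * (D x z / \<eta>)"
        using Dnn \<eta> by simp
      have "(\<Sum>y\<in>G. L0 y z) - (\<Sum>y\<in>G. L0 y x) \<le> (\<Sum>y\<in>G. 2 * (D x z / \<eta>))"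
        unfolding sum_subtractf[symmetric]
        using L0lip[of _ x z] by (intro sum_mono) (simp add: abs_le_iff)
      also have "\<dots> = 2 * (D x z / \<eta>) * real (card G)"
        by simp
      also have "\<dots> \<le> \<mu> z / 8"
        using e mult_left_mono[OF _ nn, of "real (card G)" "real (card G) + 1"] by simp
      finally have "(\<Sum>y\<in>G. L0 y x) \<ge> 1 - \<mu> z / 4"
        using G by linarith
      moreover have "L0 y x + (\<Sum>y\<in>G. L0 y x) \<le> 1"
        using L0le[of "insert y G" x] G y by simp
      moreover have "2 * (D x z / \<eta>) \<le> \<mu> z / 8"
        using e mult_left_mono[OF _ nn, of 1 "real (card G) + 1"] by simp
      then have "\<mu> x \<ge> \<mu> z - \<mu> z / 8"
        using \<mu>lip[of x z] by linarith
      ultimately show ?thesis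
        using \<mu>pos[of z] by (simp add: L1_def)
    qed
    ultimately show ?thesis
      using G(1) by blast
  qed
  define T where "T x = (\<Sum>y\<in>{y. L1 y x \<noteq> 0}. L1 y x)" for x
  have T_eq: "T x = (\<Sum>y\<in>G. L1 y x)" if "finite G" "\<And>y. y \<notin> G \<Longrightarrow> L1 y x = 0" for G x
    unfolding T_def using that by (intro sum.mono_neutral_left) auto
  have Tpos: "0 < T x" for x
  proof -
    obtain \<rho> G where G: "\<rho> > 0" "finite G" "\<forall>y. D y x < \<rho> \<longrightarrow> (\<forall>v. v \<notin> G \<longrightarrow> L1 v y = 0)"
      using locfin by blast
    then have G0: "\<And>v. v \<notin> G \<Longrightarrow> L1 v x = 0"
      using D0 by auto
    obtain y where y: "0 < L1 y x"
      using L1pos by blast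
    then have "y \<in> G"
      using G0 by force
    then have "L1 y x \<le> T x"
      using T_eq[OF G(2), of x] G0 member_le_sum[of y G "\<lambda>y. L1 y x"] G(2) L1nn by auto
    then show ?thesis using y by linarith
  qed
  have L1cont: "(\<lambda>k. L1 y (X k)) \<longlonglongrightarrow> L1 y z" if X: "(\<lambda>k. D (X k) z) \<longlonglongrightarrow> 0" for y X z
  proof -
    have "(\<lambda>k. 3 * (D (X k) z / \<eta>)) \<longlonglongrightarrow> 3 * (0 / \<eta>)"
      using \<eta> by (intro tendsto_mult tendsto_const tendsto_divide X) simp
    then have "(\<lambda>k. 3 * (D (X k) z / \<eta>)) \<longlonglongrightarrow> 0"
      by simp
    then have "(\<lambda>k. L1 y (X k) - L1 y z) \<longlonglongrightarrow> 0"
      by (rule Lim_null_comparison[rotated]) (intro always_eventually allI, simp only: real_norm_def L1lip)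
    then show ?thesis
      by (simp add: LIM_zero_iff)
  qed
  show ?thesis
  proof (rule that[of "\<lambda>y x. L1 y x / T x"])
    show "0 \<le> L1 y x / T x" for y x
      using L1nn Tpos by (simp add: less_imp_le)
    show "D x y < \<eta>" if "0 < L1 y x / T x" for y x
    proof -
      have "0 < L1 y x"
        using that Tpos[of x] by (simp add: zero_less_divide_iff)
      then have "0 < L0 y x"
        using \<mu>pos[of x] by (auto simp: L1_def max_def split: if_splits)
      then have "0 < \<phi> y x"
        using M0[of y x] by (auto simp: L0_def max_def split: if_splits)
      then show ?thesis
        using \<eta> by (auto simp: \<phi>_def max_def field_simps split: if_splits)
    qed
    show "\<exists>\<rho>>0. \<exists>G. finite G \<and> (\<forall>x. D x z < \<rho> \<longrightarrow>
        (\<forall>y. y \<notin> G \<longrightarrow> L1 y x / T x = 0) \<and> (\<Sum>y\<in>G. L1 y x / T x) = 1)" for z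
    proof -
      obtain \<rho> G where G: "\<rho> > 0" "finite G" "\<forall>x. D x z < \<rho> \<longrightarrow> (\<forall>v. v \<notin> G \<longrightarrow> L1 v x = 0)"
        using locfin by blast
      have "(\<Sum>y\<in>G. L1 y x / T x) = 1" if "D x z < \<rho>" for x
        using T_eq[of G x] G that Tpos[of x] by (simp add: sum_divide_distrib[symmetric])
      then show ?thesis
        using G by (intro exI[of _ \<rho>] conjI exI[of _ G]) auto
    qed
    show "(\<lambda>k. L1 y (X k) / T (X k)) \<longlonglongrightarrow> L1 y z / T z"
      if X: "(\<lambda>k. D (X k) z) \<longlonglongrightarrow> 0" for y X z
    proof -
      obtain \<rho> G where G: "\<rho> > 0" "finite G" "\<forall>x. D x z < \<rho> \<longrightarrow> (\<forall>v. v \<notin> G \<longrightarrow> L1 v x = 0)"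
        using locfin by blast
      have "\<forall>\<^sub>F k in sequentially. D (X k) z < \<rho>"
        using order_tendstoD(2)[OF X G(1)] .
      then have ev: "\<forall>\<^sub>F k in sequentially. (\<Sum>y\<in>G. L1 y (X k)) = T (X k)"
        by (rule eventually_mono) (use G T_eq in auto)
      have "(\<lambda>k. \<Sum>y\<in>G. L1 y (X k)) \<longlonglongrightarrow> (\<Sum>y\<in>G. L1 y z)"
        by (intro tendsto_sum L1cont X)
      then have "(\<lambda>k. T (X k)) \<longlonglongrightarrow> T z"
        using T_eq[of G z] G D0 by (simp add: tendsto_cong[OF ev])
      then show ?thesis
        using Tpos[of z] by (intro tendsto_divide L1cont X) auto
    qed
  qed
qed

section \<open>Separated sequences in metrizable locally convex spaces\<close>

text \<open>A maximal separated set, given by Zorn's lemma, is a net for the same distance. If all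
  separated sets were countable, the union of such nets for the distances \<open>1 / (n + 1)\<close>
  would be countable and dense.\<close>

lemma (in Metric_space) nonseparable_imp_uncountable_separated:
  assumes "\<not> separable_space mtopology"
  shows "\<exists>\<epsilon>>0. \<exists>A\<subseteq>M. uncountable A \<and> (\<forall>x\<in>A. \<forall>y\<in>A. x \<noteq> y \<longrightarrow> \<epsilon> \<le> d x y)"
proof (rule ccontr)
  assume "\<not> ?thesis"
  then have cnt: "countable A"
    if "\<epsilon> > 0" "A \<subseteq> M" "\<And>x y. x \<in> A \<Longrightarrow> y \<in> A \<Longrightarrow> x \<noteq> y \<Longrightarrow> \<epsilon> \<le> d x y" for \<epsilon> A
    using that by blast
  have "\<exists>A\<subseteq>M. countable A \<and> (\<forall>x\<in>M. \<exists>a\<in>A. d x a < \<epsilon>)" if \<epsilon>: "\<epsilon> > 0" for \<epsilon>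
  proof -
    define \<A> where "\<A> = {A. A \<subseteq> M \<and> (\<forall>x\<in>A. \<forall>y\<in>A. x \<noteq> y \<longrightarrow> \<epsilon> \<le> d x y)}"
    have "\<exists>A\<in>\<A>. \<forall>X\<in>\<A>. A \<subseteq> X \<longrightarrow> X = A"
    proof (rule subset_Zorn')
      fix \<C> assume ch: "subset.chain \<A> \<C>"
      have "\<epsilon> \<le> d x y" if xy: "x \<in> \<Union>\<C>" "y \<in> \<Union>\<C>" "x \<noteq> y" for x y
      proof -
        obtain X Y where XY: "X \<in> \<C>" "Y \<in> \<C>" "x \<in> X" "y \<in> Y"
          using xy by blast
        have "X \<subseteq> Y \<or> Y \<subseteq> X" "X \<in> \<A>" "Y \<in> \<A>"
          using ch XY(1,2) unfolding subset_chain_def by blast+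
        then obtain Z where Z: "Z \<in> \<A>" "x \<in> Z" "y \<in> Z"
          using XY(3,4) by blast
        then show ?thesis
          using xy(3) by (simp add: \<A>_def)
      qed
      moreover have "\<Union>\<C> \<subseteq> M"
        using ch by (auto simp: subset_chain_def \<A>_def)
      ultimately show "\<Union>\<C> \<in> \<A>"
        by (simp add: \<A>_def)
    qed
    then obtain A where A: "A \<in> \<A>" "\<And>X. X \<in> \<A> \<Longrightarrow> A \<subseteq> X \<Longrightarrow> X = A"
      by blast
    have "\<exists>a\<in>A. d x a < \<epsilon>" if x: "x \<in> M" for x
    proof (rule ccontr)
      assume "\<not> ?thesis"
      then have far: "\<epsilon> \<le> d x a" if "a \<in> A" for a
        using that by (meson linorder_not_le)
      then have "insert x A \<in> \<A>"
        using A(1) x by (auto simp: \<A>_def commute)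
      then have "x \<in> A"
        using A(2)[of "insert x A"] by blast
      then show False
        using far[of x] x \<epsilon> by simp
    qed
    moreover have "countable A" "A \<subseteq> M"
      using A(1) cnt[OF \<epsilon>, of A] by (auto simp: \<A>_def)
    ultimately show ?thesis by blast
  qed
  then have "\<forall>n. \<exists>A\<subseteq>M. countable A \<and> (\<forall>x\<in>M. \<exists>a\<in>A. d x a < 1 / (real n + 1))"
    by simp
  then obtain A where A: "\<And>n. A n \<subseteq> M" "\<And>n. countable (A n)"
      "\<And>n x. x \<in> M \<Longrightarrow> \<exists>a\<in>A n. d x a < 1 / (real n + 1)"
    by metis
  have "mtopology closure_of (\<Union>n. A n) = M"
  proof -
    have "\<exists>y\<in>\<Union>n. A n. y \<in> mball x r" if "x \<in> M" "r > 0" for x r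
    proof -
      obtain n where n: "1 / (real n + 1) < r"
        using reals_Archimedean[OF \<open>r > 0\<close>] by (auto simp: inverse_eq_divide add.commute)
      obtain a where "a \<in> A n" "d x a < 1 / (real n + 1)"
        using A(3)[OF \<open>x \<in> M\<close>] by blast
      then show ?thesis
        using n A(1)[of n] \<open>x \<in> M\<close> by (intro bexI[of _ a]) auto
    qed
    then show ?thesis
      by (auto simp: metric_closure_of)
  qed
  moreover have "countable (\<Union>n. A n)" "(\<Union>n. A n) \<subseteq> M"
    using A by auto
  ultimately show False
    using assms unfolding separable_space_def by (metis topspace_mtopology)
qed

section \<open>F-norms and sequential convergence\<close>

text \<open>\<open>nm x\<close> stands for the distance of \<open>x\<close> to 0, which need not be
  homogeneous. Balls need not be convex either, so local convexity is expressed by convex hulls of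
  small balls being small. Continuity of scaling and completeness take sequential form.\<close>

locale fnormed_space =
  fixes nm :: "'a::real_vector \<Rightarrow> real"
  assumes nm_zero [simp]: "nm 0 = 0"
    and nm_eq_0: "nm x = 0 \<Longrightarrow> x = 0"
    and nm_nonneg [simp]: "0 \<le> nm x"
    and nm_minus [simp]: "nm (- x) = nm x"
    and nm_triangle: "nm (x + y) \<le> nm x + nm y"
    and nm_scaleR_tendsto: "a \<longlonglongrightarrow> \<alpha> \<Longrightarrow> (\<lambda>k. nm (X k - z)) \<longlonglongrightarrow> 0
      \<Longrightarrow> (\<lambda>k. nm (a k *\<^sub>R X k - \<alpha> *\<^sub>R z)) \<longlonglongrightarrow> 0"
    and nm_convex: "\<epsilon> > 0 \<Longrightarrow> \<exists>\<rho>>0. convex hull {x. nm x < \<rho>} \<subseteq> {x. nm x < \<epsilon>}"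
    and nm_complete: "(\<And>\<epsilon>. \<epsilon> > 0 \<Longrightarrow> \<exists>K. \<forall>m\<ge>K. \<forall>n\<ge>K. nm (X m - X n) < \<epsilon>)
      \<Longrightarrow> \<exists>z. (\<lambda>k. nm (X k - z)) \<longlonglongrightarrow> 0"
begin

definition cvg :: "(nat \<Rightarrow> 'a) \<Rightarrow> 'a \<Rightarrow> bool"
  where "cvg X z \<longleftrightarrow> (\<lambda>k. nm (X k - z)) \<longlonglongrightarrow> 0"

lemma nm_sym: "nm (x - y) = nm (y - x)"
  using nm_minus[of "x - y"] by simp

lemma nm_triangle3: "nm (x - z) \<le> nm (x - y) + nm (y - z)"
  using nm_triangle[of "x - y" "y - z"] by simp

lemma nm_triangle_sub: "nm (x - y) \<le> nm x + nm y"
  using nm_triangle[of x "- y"] by simp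

lemma cvg_const [simp, intro]: "cvg (\<lambda>_. z) z"
  by (simp add: cvg_def)

lemma cvg_squeeze:
  assumes "h \<longlonglongrightarrow> 0" "\<And>k. nm (X k - z) \<le> h k"
  shows "cvg X z"
  unfolding cvg_def by (rule Lim_null_comparison[OF _ assms(1)]) (simp add: assms(2))

lemma cvg_add:
  assumes "cvg X x" "cvg Y y" shows "cvg (\<lambda>k. X k + Y k) (x + y)"
proof (rule cvg_squeeze)
  show "(\<lambda>k. nm (X k - x) + nm (Y k - y)) \<longlonglongrightarrow> 0"
    using tendsto_add[of _ 0 _ _ 0] assms by (simp add: cvg_def)
  show "nm (X k + Y k - (x + y)) \<le> nm (X k - x) + nm (Y k - y)" for k
    using nm_triangle[of "X k - x" "Y k - y"] by (simp add: algebra_simps)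
qed

lemma cvg_scaleR: "a \<longlonglongrightarrow> \<alpha> \<Longrightarrow> cvg X z \<Longrightarrow> cvg (\<lambda>k. a k *\<^sub>R X k) (\<alpha> *\<^sub>R z)"
  unfolding cvg_def by (rule nm_scaleR_tendsto)

lemma cvg_minus: "cvg X x \<Longrightarrow> cvg (\<lambda>k. - X k) (- x)"
  using cvg_scaleR[OF tendsto_const[of "-1"], of X x] by simp

lemma cvg_diff: "cvg X x \<Longrightarrow> cvg Y y \<Longrightarrow> cvg (\<lambda>k. X k - Y k) (x - y)"
  using cvg_add[of X x "\<lambda>k. - Y k" "- y"] cvg_minus[of Y y] by simp

lemma cvg_sum:
  assumes "\<And>i. i \<in> G \<Longrightarrow> cvg (X i) (x i)"
  shows "cvg (\<lambda>k. \<Sum>i\<in>G. X i k) (\<Sum>i\<in>G. x i)"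
  using assms by (induction G rule: infinite_finite_induct) (auto intro!: cvg_add)

lemma cvg_eventually: "cvg X z \<Longrightarrow> \<epsilon> > 0 \<Longrightarrow> \<forall>\<^sub>F k in sequentially. nm (X k - z) < \<epsilon>"
  unfolding cvg_def by (rule order_tendstoD)

lemma cvg_cong:
  assumes "\<forall>\<^sub>F k in sequentially. X k = Y k" shows "cvg X z \<longleftrightarrow> cvg Y z"
  unfolding cvg_def using assms by (intro tendsto_cong) (auto elim: eventually_mono)

text \<open>Points violating the bound at distance less than \<open>1 / (k + 1)\<close> from
  \<open>z\<close> would form a sequence converging to \<open>z\<close>. Only upper bounds are
  treated; lower bounds follow by passing to \<open>- g\<close>.\<close>

lemma sequential_small:
  fixes g :: "'a \<Rightarrow> real"
  assumes g: "\<And>X. (\<And>k. X k \<in> S) \<Longrightarrow> cvg X z \<Longrightarrow> (\<lambda>k. g (X k)) \<longlonglongrightarrow> c" and "c < \<epsilon>"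
  shows "\<exists>\<rho>>0. \<forall>x\<in>S. nm (x - z) < \<rho> \<longrightarrow> g x < \<epsilon>"
proof (rule ccontr)
  assume "\<not> ?thesis"
  then have "\<forall>k. \<exists>x\<in>S. nm (x - z) < 1 / (real k + 1) \<and> \<epsilon> \<le> g x"
    by (smt (verit) divide_pos_pos of_nat_0_le_iff)
  then obtain X where X: "\<And>k. X k \<in> S" "\<And>k. nm (X k - z) < 1 / (real k + 1)" "\<And>k. \<epsilon> \<le> g (X k)"
    by metis
  have "(\<lambda>k. 1 / (real k + 1)) \<longlonglongrightarrow> 0"
    using LIMSEQ_inverse_real_of_nat by (simp add: inverse_eq_divide add.commute)
  then have "cvg X z"
    by (rule cvg_squeeze) (simp add: X(2) less_imp_le)
  then have "(\<lambda>k. g (X k)) \<longlonglongrightarrow> c"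
    using X(1) by (intro g)
  then have "\<epsilon> \<le> c"
    by (rule LIMSEQ_le_const) (use X(3) in auto)
  then show False using assms(2) by simp
qed

text \<open>\<open>nm\<close> need not be monotone along rays, but a shrunken vector stays in the
  convex hull of a ball around 0, which local convexity keeps small.\<close>

lemma nm_scaleR_ball:
  assumes "\<epsilon> > 0"
  shows "\<exists>\<rho>>0. \<forall>s y. 0 \<le> s \<longrightarrow> s \<le> 1 \<longrightarrow> nm y < \<rho> \<longrightarrow> nm (s *\<^sub>R y) < \<epsilon>"
proof -
  obtain \<rho> where \<rho>: "\<rho> > 0" "convex hull {x. nm x < \<rho>} \<subseteq> {x. nm x < \<epsilon>}"
    using nm_convex[OF assms] by blast
  have "s *\<^sub>R y \<in> convex hull {x. nm x < \<rho>}" if "0 \<le> s" "s \<le> 1" "nm y < \<rho>" for s y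
  proof -
    have "y \<in> convex hull {x. nm x < \<rho>}" "0 \<in> convex hull {x. nm x < \<rho>}"
      using that \<rho>(1) by (auto intro!: hull_inc)
    from convexD[OF convex_convex_hull this, of s "1 - s"] show ?thesis
      using that by simp
  qed
  then show ?thesis using \<rho> by blast
qed

text \<open>Continuity of scaling at the scalar 0: every single vector is absorbed by every
  ball.\<close>

lemma nm_scaleR_small:
  assumes "\<epsilon> > 0"
  shows "\<exists>t>0. \<forall>s. 0 \<le> s \<longrightarrow> s \<le> t \<longrightarrow> nm (s *\<^sub>R x) < \<epsilon>"
proof (rule ccontr)
  assume "\<not> ?thesis"
  then have "\<forall>k. \<exists>s. 0 \<le> s \<and> s \<le> 1 / (real k + 1) \<and> \<epsilon> \<le> nm (s *\<^sub>R x)"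
    by (smt (verit) divide_pos_pos of_nat_0_le_iff)
  then obtain s where s: "\<And>k. 0 \<le> s k" "\<And>k. s k \<le> 1 / (real k + 1)" "\<And>k. \<epsilon> \<le> nm (s k *\<^sub>R x)"
    by metis
  have "(\<lambda>k. 1 / (real k + 1)) \<longlonglongrightarrow> 0"
    using LIMSEQ_inverse_real_of_nat by (simp add: inverse_eq_divide add.commute)
  then have "s \<longlonglongrightarrow> 0"
    by (rule Lim_null_comparison[rotated]) (simp add: s)
  from cvg_scaleR[OF this cvg_const[of x]] have "(\<lambda>k. nm (s k *\<^sub>R x)) \<longlonglongrightarrow> 0"
    by (simp add: cvg_def)
  then have "\<epsilon> \<le> 0"
    by (rule LIMSEQ_le_const) (use s(3) in auto)
  then show False using assms by simp
qed

section \<open>Continuous seminorms\<close>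

definition cseminorm :: "('a \<Rightarrow> real) \<Rightarrow> bool"
  where "cseminorm p \<longleftrightarrow> (\<forall>x. 0 \<le> p x) \<and> (\<forall>x y. p (x + y) \<le> p x + p y) \<and>
    (\<forall>a x. p (a *\<^sub>R x) = \<bar>a\<bar> * p x) \<and> (\<forall>\<eta>>0. \<exists>\<rho>>0. \<forall>x. nm x < \<rho> \<longrightarrow> p x < \<eta>)"

lemma cseminorm_cmul:
  assumes p: "cseminorm p" and "0 < c"
  shows "cseminorm (\<lambda>x. c * p x)"
  unfolding cseminorm_def
proof (intro conjI allI impI)
  fix x y a and \<eta> :: real
  show "0 \<le> c * p x" "c * p (a *\<^sub>R x) = \<bar>a\<bar> * (c * p x)"
    using assms by (auto simp: cseminorm_def)
  show "c * p (x + y) \<le> c * p x + c * p y"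
    using assms mult_left_mono[of "p (x + y)" "p x + p y" c] by (auto simp: cseminorm_def distrib_left)
  assume "0 < \<eta>"
  then have "\<eta> / c > 0"
    using assms by simp
  then obtain \<rho> where "\<rho> > 0" "\<forall>x. nm x < \<rho> \<longrightarrow> p x < \<eta> / c"
    using p unfolding cseminorm_def by blast
  then show "\<exists>\<rho>>0. \<forall>x. nm x < \<rho> \<longrightarrow> c * p x < \<eta>"
    using assms(2) by (intro exI[of _ \<rho>]) (auto simp: field_simps)
qed

text \<open>The Minkowski functional of a convex neighbourhood of zero.\<close>

lemma ex_cseminorm:
  assumes "\<epsilon> > 0"
  shows "\<exists>p. cseminorm p \<and> (\<forall>x. p x < 1 \<longrightarrow> nm x < \<epsilon>)"
proof -
  obtain \<rho> where \<rho>: "\<rho> > 0" "convex hull {x. nm x < \<rho>} \<subseteq> {x. nm x < \<epsilon>}"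
    using nm_convex[OF assms] by blast
  define W where "W = convex hull {x. nm x < \<rho>}"
  have cW: "convex W"
    by (simp add: W_def)
  have inW: "x \<in> W" if "nm x < \<rho>" for x
    unfolding W_def using that by (intro hull_inc) auto
  \<comment> \<open>The hull inherits symmetry from the ball; this gives
    \<open>p (- x) = p x\<close> below.\<close>
  have mW: "- x \<in> W" if "x \<in> W" for x
  proof -
    have "linear (\<lambda>x :: 'a. - x)"
      by (simp add: linear_iff)
    then have "uminus ` W = convex hull (uminus ` {x. nm x < \<rho>})"
      unfolding W_def by (rule convex_hull_linear_image)
    also have "uminus ` {x. nm x < \<rho>} = {x. nm x < \<rho>}"
      by (force intro: image_eqI[of _ _ "- _"])
    finally show ?thesis
      using that by (metis W_def image_eqI)
  qed
  define A where "A x = {t. 0 < t \<and> (1 / t) *\<^sub>R x \<in> W}" for x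
  define p where "p x = Inf (A x)" for x
  have Abdd: "bdd_below (A x)" for x
    by (rule bdd_belowI[of _ 0]) (auto simp: A_def)
  have Ane: "A x \<noteq> {}" for x
  proof -
    obtain t where "t > 0" "nm (t *\<^sub>R x) < \<rho>"
      using nm_scaleR_small[OF \<rho>(1), of x] by (meson less_imp_le order_refl)
    then have "1 / t \<in> A x"
      by (auto simp: A_def intro: inW)
    then show ?thesis by blast
  qed
  \<comment> \<open>\<open>W\<close> is convex and contains 0, so the admissible scales form an
    upward closed set.\<close>
  have Ainc: "t' \<in> A x" if "t \<in> A x" "t \<le> t'" for t t' x
  proof -
    have "(t / t') *\<^sub>R ((1 / t) *\<^sub>R x) + (1 - t / t') *\<^sub>R 0 \<in> W"
      using that \<rho>(1) by (intro convexD[OF cW]) (auto simp: A_def field_simps intro: inW)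
    then show ?thesis
      using that by (auto simp: A_def)
  qed
  have p_le: "p x \<le> t" if "t \<in> A x" for x t
    unfolding p_def using that Abdd by (rule cInf_lower)
  have p_less: "s \<in> A x" if "p x < s" for x s
    using that cInf_less_iff[OF Ane Abdd, of x s] Ainc unfolding p_def by fastforce
  have p_nonneg: "0 \<le> p x" for x
    unfolding p_def using Ane by (intro cInf_greatest) (auto simp: A_def)
  have p_add: "p (x + y) \<le> p x + p y" for x y
  proof (rule field_le_epsilon)
    fix e :: real assume "0 < e"
    define s t where "s = p x + e / 2" and "t = p y + e / 2"
    have st: "s \<in> A x" "t \<in> A y"
      using \<open>0 < e\<close> by (auto simp: s_def t_def intro!: p_less)
    then have pos: "0 < s" "0 < t"
      by (auto simp: A_def)
    have "(s / (s + t)) *\<^sub>R ((1 / s) *\<^sub>R x) + (t / (s + t)) *\<^sub>R ((1 / t) *\<^sub>R y) \<in> W"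
      using st pos by (intro convexD[OF cW]) (auto simp: A_def add_divide_distrib[symmetric])
    then have "s + t \<in> A (x + y)"
      using pos by (simp add: A_def scaleR_add_right)
    then show "p (x + y) \<le> p x + p y + e"
      using p_le by (fastforce simp: s_def t_def)
  qed
  have p_scale_le: "p (a *\<^sub>R x) \<le> a * p x" if "0 < a" for a x
  proof (rule field_le_epsilon)
    fix e :: real assume "0 < e"
    have "p x + e / a \<in> A x"
      using \<open>0 < e\<close> that by (intro p_less) auto
    then have "a * (p x + e / a) \<in> A (a *\<^sub>R x)"
      using that by (auto simp: A_def)
    from p_le[OF this] show "p (a *\<^sub>R x) \<le> a * p x + e"
      using that by (simp add: distrib_left)
  qed
  have p_scale_pos: "p (a *\<^sub>R x) = a * p x" if "0 < a" for a x
    using p_scale_le[OF that, of x] p_scale_le[of "1 / a" "a *\<^sub>R x"] that by (simp add: field_simps)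
  have p_minus: "p (- x) = p x" for x
  proof -
    have "A (- x) = A x" for x
      using mW by (force simp: A_def)
    then show ?thesis by (simp add: p_def)
  qed
  have p_zero: "p 0 = 0"
  proof (rule antisym[OF field_le_epsilon p_nonneg])
    fix e :: real assume "0 < e"
    then have "e \<in> A 0"
      using \<rho>(1) by (auto simp: A_def intro: inW)
    then show "p 0 \<le> 0 + e"
      using p_le by simp
  qed
  have p_scale: "p (a *\<^sub>R x) = \<bar>a\<bar> * p x" for a x
  proof (cases "a = 0")
    case False
    then show ?thesis
      using p_scale_pos[of "\<bar>a\<bar>" x] p_minus[of "a *\<^sub>R x"] by (cases "a > 0") auto
  qed (simp add: p_zero)
  have p_cont: "\<exists>\<rho>'>0. \<forall>x. nm x < \<rho>' \<longrightarrow> p x < \<eta>" if "\<eta> > 0" for \<eta>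
  proof -
    \<comment> \<open>The factor \<open>2 / \<eta>\<close> puts \<open>\<eta> / 2\<close> into
      \<open>A x\<close>, which makes the bound \<open>p x < \<eta>\<close> strict.\<close>
    have "\<exists>\<rho>'>0. \<forall>x\<in>UNIV. nm (x - 0) < \<rho>' \<longrightarrow> nm ((2 / \<eta>) *\<^sub>R x) < \<rho>"
    proof (rule sequential_small[OF _ \<rho>(1)])
      fix X assume "cvg X 0"
      from cvg_scaleR[OF tendsto_const this, of "2 / \<eta>"]
      show "(\<lambda>k. nm ((2 / \<eta>) *\<^sub>R X k)) \<longlonglongrightarrow> 0"
        by (simp add: cvg_def)
    qed
    then obtain \<rho>' where \<rho>': "\<rho>' > 0" "\<And>x. nm x < \<rho>' \<Longrightarrow> nm ((2 / \<eta>) *\<^sub>R x) < \<rho>"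
      by auto
    have "p x < \<eta>" if x: "nm x < \<rho>'" for x
    proof -
      have "\<eta> / 2 \<in> A x"
        using \<rho>'(2)[OF x] inW \<open>\<eta> > 0\<close> by (auto simp: A_def)
      then show ?thesis
        using p_le \<open>\<eta> > 0\<close> by fastforce
    qed
    then show ?thesis using \<rho>'(1) by blast
  qed
  have "nm x < \<epsilon>" if "p x < 1" for x
    using p_less[OF that] \<rho>(2) by (auto simp: A_def W_def)
  then show ?thesis
    unfolding cseminorm_def using p_nonneg p_add p_scale p_cont by blast
qed

lemma cseminorm_minus: "cseminorm p \<Longrightarrow> p (x - y) = p (y - x)"
  unfolding cseminorm_def by (metis abs_minus_cancel abs_one minus_diff_eq mult_1 scaleR_minus1_left)

lemma cseminorm_triangle3: "cseminorm p \<Longrightarrow> p (x - z) \<le> p (x - y) + p (y - z)"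
  unfolding cseminorm_def by (metis diff_add_cancel add_diff_eq)

section \<open>Bounded sequences inside uncountable separated sets\<close>

text \<open>Linear combinations with rational coefficients form the net; each new generator spends
  half of the remaining tolerance.\<close>

lemma cseminorm_countable_net:
  assumes p: "cseminorm p" and "finite B" "\<eta> > 0"
  shows "\<exists>Q. countable Q \<and> (\<forall>v\<in>span B. \<exists>q\<in>Q. p (v - q) < \<eta>)"
  using assms(2,3)
proof (induction B arbitrary: \<eta> rule: finite_induct)
  case empty
  have "p 0 = 0"
    using p unfolding cseminorm_def by (metis abs_zero mult_zero_left scaleR_zero_left)
  then show ?case
    using empty by (intro exI[of _ "{0}"]) auto
next
  case (insert a B)
  obtain Q where Q: "countable Q" "\<And>v. v \<in> span B \<Longrightarrow> \<exists>q\<in>Q. p (v - q) < \<eta> / 2"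
    using insert.IH[of "\<eta> / 2"] insert.prems by auto
  have pa: "0 \<le> p a" and psc: "\<And>c x. p (c *\<^sub>R x) = \<bar>c\<bar> * p x"
    and padd: "\<And>x y. p (x + y) \<le> p x + p y"
    using p by (auto simp: cseminorm_def)
  define Q' where "Q' = (\<lambda>(c, q). c *\<^sub>R a + q) ` (\<rat> \<times> Q)"
  have "countable Q'"
    unfolding Q'_def using Q(1) countable_rat by blast
  moreover have "\<exists>q\<in>Q'. p (v - q) < \<eta>" if v: "v \<in> span (insert a B)" for v
  proof -
    obtain k where k: "v - k *\<^sub>R a \<in> span B"
      using v by (auto simp: span_insert)
    obtain q where q: "q \<in> Q" "p (v - k *\<^sub>R a - q) < \<eta> / 2"
      using Q(2)[OF k] by blast
    \<comment> \<open>The error in the coefficient is multiplied by \<open>p a\<close>; the added 1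
      keeps the quotient meaningful when \<open>p a = 0\<close>.\<close>
    obtain c where c: "c \<in> \<rat>" "k < c" "c < k + \<eta> / (2 * (p a + 1))"
      using Rats_dense_in_real[of k "k + \<eta> / (2 * (p a + 1))"] pa insert.prems by auto
    have "p (v - (c *\<^sub>R a + q)) \<le> p (v - k *\<^sub>R a - q) + p ((k - c) *\<^sub>R a)"
      using padd[of "v - k *\<^sub>R a - q" "(k - c) *\<^sub>R a"] by (simp add: algebra_simps)
    also have "p ((k - c) *\<^sub>R a) = (c - k) * p a"
      using c by (simp add: psc)
    also have "\<dots> \<le> \<eta> / (2 * (p a + 1)) * p a"
      using c pa by (intro mult_right_mono) auto
    also have "\<dots> \<le> \<eta> / 2"
      using pa insert.prems by (simp add: field_simps)
    finally show ?thesis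
      using q c unfolding Q'_def by (intro bexI[of _ "c *\<^sub>R a + q"]) auto
  qed
  ultimately show ?case by blast
qed

text \<open>Each vector is absorbed at some scale \<open>1 / (k + 1)\<close>, so \<open>S\<close> is
  a countable union of sets absorbed uniformly, and one of them is uncountable.\<close>

lemma uncountable_bounded_subset:
  assumes S: "uncountable S" and "\<eta> > 0"
  shows "\<exists>S'\<subseteq>S. uncountable S' \<and> (\<exists>t>0. \<forall>a\<in>S'. \<forall>s. 0 \<le> s \<longrightarrow> s \<le> t \<longrightarrow> nm (s *\<^sub>R a) < \<eta>)"
proof (rule ccontr)
  assume neg: "\<not> ?thesis"
  define T where "T k = {a \<in> S. \<forall>s. 0 \<le> s \<longrightarrow> s \<le> 1 / (real k + 1) \<longrightarrow> nm (s *\<^sub>R a) < \<eta>}" for k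
  have "countable (T k)" for k
  proof (rule ccontr)
    assume "uncountable (T k)"
    moreover have "T k \<subseteq> S" "0 < 1 / (real k + 1)"
      by (auto simp: T_def)
    moreover have "\<forall>a\<in>T k. \<forall>s. 0 \<le> s \<longrightarrow> s \<le> 1 / (real k + 1) \<longrightarrow> nm (s *\<^sub>R a) < \<eta>"
      by (auto simp: T_def)
    ultimately show False using neg by blast
  qed
  moreover have "S \<subseteq> (\<Union>k. T k)"
  proof
    fix a assume a: "a \<in> S"
    obtain t where t: "t > 0" "\<And>s. 0 \<le> s \<Longrightarrow> s \<le> t \<Longrightarrow> nm (s *\<^sub>R a) < \<eta>"
      using nm_scaleR_small[OF \<open>\<eta> > 0\<close>] by blast
    obtain k :: nat where "1 / (real k + 1) < t"
      using reals_Archimedean[OF t(1)] by (auto simp: inverse_eq_divide add.commute)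
    then show "a \<in> (\<Union>k. T k)"
      using a t(2) by (auto simp: T_def intro!: exI[of _ k])
  qed
  ultimately show False
    using S by (meson countable_UN countableI_type countable_subset)
qed

text \<open>Non-separability is used here: a bounded sequence without Cauchy
  subsequences exists because an uncountable separated set can be thinned out, keeping it
  uncountable, so as to satisfy any one boundedness requirement.\<close>

lemma ex_bounded_separated_sequence:
  assumes A: "uncountable A" and p: "cseminorm p"
    and sep: "\<And>a a'. a \<in> A \<Longrightarrow> a' \<in> A \<Longrightarrow> a \<noteq> a' \<Longrightarrow> 4 \<le> p (a - a')"
  obtains e :: "nat \<Rightarrow> 'a"
  where "\<And>n. e n \<in> A"
    "\<And>\<eta>. \<eta> > 0 \<Longrightarrow> \<exists>t>0. \<forall>s n. 0 \<le> s \<longrightarrow> s \<le> t \<longrightarrow> nm (s *\<^sub>R e n) < \<eta>"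
    "\<And>n v. v \<in> span (e ` {..<n}) \<Longrightarrow> 1 \<le> p (e n - v)"
proof -
  \<comment> \<open>The decreasing sets \<open>S n\<close> meet the boundedness requirements for the
    radii \<open>1 / (n + 1)\<close> one after the other. A sequence with
    \<open>e n \<in> S n\<close> then satisfies each requirement from some index on.\<close>
  have "\<exists>S. \<forall>n. (uncountable (S n) \<and> S n \<subseteq> A) \<and> (S (Suc n) \<subseteq> S n \<and>
      (\<exists>t>0. \<forall>a\<in>S (Suc n). \<forall>s. 0 \<le> s \<longrightarrow> s \<le> t \<longrightarrow> nm (s *\<^sub>R a) < 1 / (real n + 1)))"
  proof (rule dependent_nat_choice)
    show "\<exists>S. uncountable S \<and> S \<subseteq> A"
      using A by blast
    show "\<exists>S'. (uncountable S' \<and> S' \<subseteq> A) \<and> (S' \<subseteq> S \<and>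
        (\<exists>t>0. \<forall>a\<in>S'. \<forall>s. 0 \<le> s \<longrightarrow> s \<le> t \<longrightarrow> nm (s *\<^sub>R a) < 1 / (real n + 1)))"
      if "uncountable S \<and> S \<subseteq> A" for S and n :: nat
      using uncountable_bounded_subset[of S "1 / (real n + 1)"] that
      by (auto intro: order_trans)
  qed
  then obtain S where S: "\<And>n. uncountable (S n)" "\<And>n. S n \<subseteq> A" "\<And>n. S (Suc n) \<subseteq> S n"
    and Sb: "\<And>n. \<exists>t>0. \<forall>a\<in>S (Suc n). \<forall>s. 0 \<le> s \<longrightarrow> s \<le> t \<longrightarrow> nm (s *\<^sub>R a) < 1 / (real n + 1)"
    by metis
  have Santi: "S n \<subseteq> S m" if "m \<le> n" for m n
    using lift_Suc_antimono_le[of S] S(3) that by blast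
  have "\<exists>e. \<forall>n. e n \<in> S n \<and> (\<forall>v\<in>span (e ` {..<n}). 1 \<le> p (e n - v))"
  proof (rule dependent_wellorder_choice)
    show "(r \<in> S n \<and> (\<forall>v\<in>span (f ` {..<n}). 1 \<le> p (r - v))) =
      (r \<in> S n \<and> (\<forall>v\<in>span (g ` {..<n}). 1 \<le> p (r - v)))"
      if "\<And>m. m < n \<Longrightarrow> f m = g m" for r f g n
    proof -
      have "f ` {..<n} = g ` {..<n}"
        using that by auto
      then show ?thesis by simp
    qed
  next
    fix n :: nat and f :: "nat \<Rightarrow> 'a"
    show "\<exists>r. r \<in> S n \<and> (\<forall>v\<in>span (f ` {..<n}). 1 \<le> p (r - v))"
    proof (rule ccontr)
      assume "\<not> ?thesis"
      then have near: "\<exists>v\<in>span (f ` {..<n}). p (r - v) < 1" if "r \<in> S n" for r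
        using that by (meson not_le_imp_less)
      obtain Q where Q: "countable Q" "\<And>v. v \<in> span (f ` {..<n}) \<Longrightarrow> \<exists>q\<in>Q. p (v - q) < 1"
        using cseminorm_countable_net[OF p, of "f ` {..<n}" 1] by auto
      \<comment> \<open>If no further vector could be chosen, \<open>S n\<close> would lie within 2
        of a countable set. By the separation constant 4, distinct points have distinct neighbours
        in \<open>Q\<close>, which would make \<open>S n\<close> countable.\<close>
      have "\<exists>q\<in>Q. p (r - q) < 2" if r: "r \<in> S n" for r
      proof -
        obtain v q where "v \<in> span (f ` {..<n})" "p (r - v) < 1" "q \<in> Q" "p (v - q) < 1"
          using near[OF r] Q(2) by blast
        then show ?thesis
          using cseminorm_triangle3[OF p, of r q v] by (intro bexI[of _ q]) auto
      qed
      then obtain q where q: "\<And>r. r \<in> S n \<Longrightarrow> q r \<in> Q" "\<And>r. r \<in> S n \<Longrightarrow> p (r - q r) < 2"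
        by metis
      have "inj_on q (S n)"
      proof (rule inj_onI, rule ccontr)
        fix r r' assume r: "r \<in> S n" "r' \<in> S n" "q r = q r'" "r \<noteq> r'"
        have "p (r - r') < 4"
          using cseminorm_triangle3[OF p, of r r' "q r"] cseminorm_minus[OF p, of "q r" r']
            q(2)[OF r(1)] q(2)[OF r(2)] r(3) by simp
        then show False
          using sep[of r r'] r S(2)[of n] by auto
      qed
      moreover have "countable (q ` S n)"
        using Q(1) q(1) by (meson countable_subset image_subsetI)
      ultimately show False
        using S(1) countable_image_inj_on by blast
    qed
  qed
  then obtain e where e: "\<And>n. e n \<in> S n" "\<And>n v. v \<in> span (e ` {..<n}) \<Longrightarrow> 1 \<le> p (e n - v)"
    by blast
  show ?thesis
  proof (rule that[of e])
    show "e n \<in> A" for n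
      using e(1) S(2) by blast
    show "1 \<le> p (e n - v)" if "v \<in> span (e ` {..<n})" for n v
      using e(2) that .
    fix \<eta> :: real assume \<eta>: "\<eta> > 0"
    obtain N where N: "1 / (real N + 1) < \<eta>"
      using reals_Archimedean[OF \<eta>] by (auto simp: inverse_eq_divide add.commute)
    obtain t where t: "t > 0" "\<And>a s. a \<in> S (Suc N) \<Longrightarrow> 0 \<le> s \<Longrightarrow> s \<le> t \<Longrightarrow> nm (s *\<^sub>R a) < 1 / (real N + 1)"
      using Sb[of N] by blast
    obtain \<tau> where \<tau>: "\<And>n. \<tau> n > 0" "\<And>n s. 0 \<le> s \<Longrightarrow> s \<le> \<tau> n \<Longrightarrow> nm (s *\<^sub>R e n) < \<eta>"
    proof -
      have "\<forall>n. \<exists>t>0. \<forall>s. 0 \<le> s \<longrightarrow> s \<le> t \<longrightarrow> nm (s *\<^sub>R e n) < \<eta>"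
        using nm_scaleR_small[OF \<eta>] by blast
      then show ?thesis
        using that by metis
    qed
    \<comment> \<open>From index \<open>N + 1\<close> on the scale \<open>t\<close> works because
      \<open>e n\<close> lies in \<open>S (Suc N)\<close>; the finitely many earlier vectors have
      their own scales.\<close>
    define t' where "t' = Min (insert t (\<tau> ` {..N}))"
    have "t' > 0"
      using t(1) \<tau>(1) by (auto simp: t'_def)
    moreover have "nm (s *\<^sub>R e n) < \<eta>" if s: "0 \<le> s" "s \<le> t'" for s n
    proof (cases "n \<le> N")
      case True
      then have "t' \<le> \<tau> n"
        unfolding t'_def by (intro Min_le) auto
      then show ?thesis using \<tau>(2) s by auto
    next
      case False
      then have "e n \<in> S (Suc N)"
        using e(1)[of n] Santi[of "Suc N" n] by auto
      moreover have "t' \<le> t"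
        unfolding t'_def by (intro Min_le) auto
      ultimately show ?thesis
        using t(2)[of "e n" s] s N by auto
    qed
    ultimately show "\<exists>t>0. \<forall>s n. 0 \<le> s \<longrightarrow> s \<le> t \<longrightarrow> nm (s *\<^sub>R e n) < \<eta>"
      by blast
  qed
qed

section \<open>The Bartle--Graves theorem\<close>

text \<open>For a subspace \<open>L\<close>, \<open>dst L (x - y)\<close> is the pseudometric of the
  quotient space, and \<open>dst L x = 0\<close> expresses that \<open>x\<close> lies in the closure
  of \<open>L\<close>.\<close>

definition dst :: "'a set \<Rightarrow> 'a \<Rightarrow> real"
  where "dst L x = (INF v\<in>L. nm (x - v))"

lemma dst_bdd: "bdd_below ((\<lambda>v. nm (x - v)) ` L)"
  by (rule bdd_belowI[of _ 0]) auto

lemma dst_le: "v \<in> L \<Longrightarrow> dst L x \<le> nm (x - v)"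
  unfolding dst_def by (rule cINF_lower[OF dst_bdd])

lemma dst_lessD:
  assumes "subspace L" "dst L x < c" shows "\<exists>v\<in>L. nm (x - v) < c"
  using assms subspace_0[OF assms(1)] cINF_less_iff[OF _ dst_bdd, of L x c] by (auto simp: dst_def)

lemma dst_nonneg: "subspace L \<Longrightarrow> 0 \<le> dst L x"
  unfolding dst_def using subspace_0[of L] by (intro cINF_greatest) auto

lemma dst_le_nm: "subspace L \<Longrightarrow> dst L x \<le> nm x"
  using dst_le[OF subspace_0, of L x] by simp

lemma dst_mem: "subspace L \<Longrightarrow> v \<in> L \<Longrightarrow> dst L v = 0"
  using dst_le[of v L v] dst_nonneg[of L v] by simp

lemma dst_self: "subspace L \<Longrightarrow> dst L (x - x) = 0"
  by (simp add: dst_mem subspace_0)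

lemma dst_triangle:
  assumes L: "subspace L" shows "dst L (x + y) \<le> dst L x + dst L y"
proof (rule field_le_epsilon)
  fix e :: real assume e: "0 < e"
  obtain v where v: "v \<in> L" "nm (x - v) < dst L x + e / 2"
    using dst_lessD[OF L, of x "dst L x + e / 2"] e by auto
  obtain w where w: "w \<in> L" "nm (y - w) < dst L y + e / 2"
    using dst_lessD[OF L, of y "dst L y + e / 2"] e by auto
  have "dst L (x + y) \<le> nm (x + y - (v + w))"
    using v w L by (intro dst_le subspace_add)
  also have "\<dots> \<le> nm (x - v) + nm (y - w)"
    using nm_triangle[of "x - v" "y - w"] by (simp add: algebra_simps)
  finally show "dst L (x + y) \<le> dst L x + dst L y + e"
    using v w by simp
qed

lemma dst_minus:
  assumes L: "subspace L" shows "dst L (- x) = dst L x"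
proof -
  have "dst L (- x) \<le> dst L x" for x
  proof (rule field_le_epsilon)
    fix e :: real assume e: "0 < e"
    obtain v where v: "v \<in> L" "nm (x - v) < dst L x + e"
      using dst_lessD[OF L, of x "dst L x + e"] e by auto
    have "dst L (- x) \<le> nm (- x - - v)"
      using v L by (intro dst_le subspace_neg)
    then show "dst L (- x) \<le> dst L x + e"
      using v nm_minus[of "x - v"] by (simp add: algebra_simps)
  qed
  from this[of x] this[of "- x"] show ?thesis by simp
qed

lemma dst_sym: "subspace L \<Longrightarrow> dst L (x - y) = dst L (y - x)"
  using dst_minus[of L "x - y"] by simp

lemma dst_triangle3: "subspace L \<Longrightarrow> dst L (x - z) \<le> dst L (x - y) + dst L (y - z)"
  using dst_triangle[of L "x - y" "y - z"] by simp

section \<open>Continuous sections of the quotient map\<close>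

text \<open>Coset representatives are averaged by a partition of unity for the quotient
  pseudometric. Convex hulls of small balls being small makes \<open>\<sigma> x\<close> nearly a
  representative of the coset of \<open>x\<close>, and small if that coset is near 0.\<close>

lemma ex_approximate_section:
  assumes L: "subspace L" and "\<zeta> > 0" "\<zeta>' > 0"
    and hull: "convex hull {x. nm x < 3 * \<zeta>} \<subseteq> {x. nm x < \<epsilon>}"
  obtains \<sigma> where "\<And>X z. cvg X z \<Longrightarrow> cvg (\<lambda>k. \<sigma> (X k)) (\<sigma> z)"
    "\<And>x s. dst L s = 0 \<Longrightarrow> \<sigma> (x + s) = \<sigma> x"
    "\<And>x. dst L (x - \<sigma> x) < \<zeta>'" "\<And>x. dst L x < \<zeta> \<Longrightarrow> nm (\<sigma> x) < \<epsilon>"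
proof -
  obtain \<eta>0 where \<eta>0: "\<eta>0 > 0" "convex hull {x. nm x < \<eta>0} \<subseteq> {x. nm x < \<zeta>'}"
    using nm_convex[OF assms(3)] by blast
  define \<eta> where "\<eta> = min \<eta>0 \<zeta>"
  have \<eta>: "\<eta> > 0" "\<eta> \<le> \<eta>0" "\<eta> \<le> \<zeta>"
    using \<eta>0 assms by (auto simp: \<eta>_def)
  obtain w :: "'a \<Rightarrow> 'a \<Rightarrow> real" where w: "\<And>y x. 0 \<le> w y x"
    "\<And>y x. 0 < w y x \<Longrightarrow> dst L (x - y) < \<eta>"
    and wfin: "\<And>z. \<exists>\<rho>>0. \<exists>G. finite G \<and> (\<forall>x. dst L (x - z) < \<rho> \<longrightarrow>
      (\<forall>y. y \<notin> G \<longrightarrow> w y x = 0) \<and> (\<Sum>y\<in>G. w y x) = 1)"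
    and wlim: "\<And>y X z. (\<lambda>k. dst L (X k - z)) \<longlonglongrightarrow> 0 \<Longrightarrow> (\<lambda>k. w y (X k)) \<longlonglongrightarrow> w y z"
    by (rule uniform_partition_of_unity[of "\<lambda>x y. dst L (x - y)" \<eta>,
          OF dst_self[OF L] dst_nonneg[OF L] dst_sym[OF L] dst_triangle3[OF L] \<eta>(1)]) (rule that)
  \<comment> \<open>A representative of the coset whose norm nearly attains the quotient distance;
    this later bounds \<open>\<sigma>\<close>.\<close>
  have "\<exists>y'. dst L (y - y') = 0 \<and> nm y' < dst L y + \<eta>" for y
  proof -
    obtain v where "v \<in> L" "nm (y - v) < dst L y + \<eta>"
      using dst_lessD[OF L, of y "dst L y + \<eta>"] \<eta>(1) by auto
    then show ?thesis
      using dst_mem[OF L] by (intro exI[of _ "y - v"]) auto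
  qed
  then obtain rep where rep: "\<And>y. dst L (y - rep y) = 0" "\<And>y. nm (rep y) < dst L y + \<eta>"
    by metis
  define supp where "supp x = {y. w y x \<noteq> 0}" for x
  define \<sigma> where "\<sigma> x = (\<Sum>y\<in>supp x. w y x *\<^sub>R rep y)" for x
  have supp_fin: "finite (supp x)" and supp_sum: "(\<Sum>y\<in>supp x. w y x) = 1" for x
  proof -
    obtain \<rho> G where G: "\<rho> > 0" "finite G" "\<forall>y. dst L (y - x) < \<rho> \<longrightarrow>
        (\<forall>v. v \<notin> G \<longrightarrow> w v y = 0) \<and> (\<Sum>v\<in>G. w v y) = 1"
      using wfin by blast
    then have G': "\<And>v. v \<notin> G \<Longrightarrow> w v x = 0" "(\<Sum>v\<in>G. w v x) = 1"
      using dst_self[OF L] by auto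
    then have "supp x \<subseteq> G"
      by (auto simp: supp_def)
    then show "finite (supp x)"
      using G(2) finite_subset by blast
    have "(\<Sum>y\<in>supp x. w y x) = (\<Sum>v\<in>G. w v x)"
      using G(2) \<open>supp x \<subseteq> G\<close> by (intro sum.mono_neutral_left) (auto simp: supp_def)
    then show "(\<Sum>y\<in>supp x. w y x) = 1"
      using G' by simp
  qed
  have supp_near: "dst L (x - y) < \<eta>" if "y \<in> supp x" for x y
    using that w(1)[of y x] by (intro w(2)) (auto simp: supp_def)
  show ?thesis
  proof (rule that[of \<sigma>])
    fix X z assume X: "cvg X z"
    have lim: "(\<lambda>k. dst L (X k - z)) \<longlonglongrightarrow> 0"
      using X unfolding cvg_def
      by (rule Lim_null_comparison[rotated]) (simp add: dst_nonneg dst_le_nm L)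
    obtain \<rho> G where G: "\<rho> > 0" "finite G" "\<forall>y. dst L (y - z) < \<rho> \<longrightarrow>
        (\<forall>v. v \<notin> G \<longrightarrow> w v y = 0) \<and> (\<Sum>v\<in>G. w v y) = 1"
      using wfin by blast
    have \<sigma>_eq: "\<sigma> x = (\<Sum>y\<in>G. w y x *\<^sub>R rep y)" if "dst L (x - z) < \<rho>" for x
      unfolding \<sigma>_def using G that by (intro sum.mono_neutral_left) (auto simp: supp_def)
    have "\<forall>\<^sub>F k in sequentially. dst L (X k - z) < \<rho>"
      using order_tendstoD(2)[OF lim G(1)] .
    then have "\<forall>\<^sub>F k in sequentially. \<sigma> (X k) = (\<Sum>y\<in>G. w y (X k) *\<^sub>R rep y)"
      by (rule eventually_mono) (rule \<sigma>_eq)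
    moreover have "cvg (\<lambda>k. \<Sum>y\<in>G. w y (X k) *\<^sub>R rep y) (\<Sum>y\<in>G. w y z *\<^sub>R rep y)"
      by (intro cvg_sum cvg_scaleR wlim lim cvg_const)
    moreover have "\<sigma> z = (\<Sum>y\<in>G. w y z *\<^sub>R rep y)"
      using G(1) dst_self[OF L] by (intro \<sigma>_eq) simp
    ultimately show "cvg (\<lambda>k. \<sigma> (X k)) (\<sigma> z)"
      using cvg_cong by force
  next
    fix x s assume s: "dst L s = 0"
    have "w y (x + s) = w y x" for y
    proof -
      \<comment> \<open>The constant sequence \<open>x + s\<close> converges to \<open>x\<close> in
        the pseudometric, so continuity of \<open>w\<close> forces equal values at both
        points.\<close>
      have "(\<lambda>k :: nat. dst L (x + s - x)) \<longlonglongrightarrow> 0"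
        using s by simp
      from wlim[OF this, of y] show ?thesis
        by (simp add: LIMSEQ_const_iff)
    qed
    then show "\<sigma> (x + s) = \<sigma> x"
      by (simp add: \<sigma>_def supp_def)
  next
    fix x
    have "\<exists>v\<in>L. nm (x - rep y - v) < \<eta>" if "y \<in> supp x" for y
    proof -
      have "dst L (x - rep y) < \<eta>"
        using dst_triangle3[OF L, of x "rep y" y] rep(1)[of y] supp_near[OF that] by simp
      then show ?thesis
        using dst_lessD[OF L] by blast
    qed
    then obtain v where v: "\<And>y. y \<in> supp x \<Longrightarrow> v y \<in> L" "\<And>y. y \<in> supp x \<Longrightarrow> nm (x - rep y - v y) < \<eta>"
      by metis
    \<comment> \<open>Modulo \<open>L\<close>, the error \<open>x - \<sigma> x\<close> is a convex
      combination of vectors of norm less than \<open>\<eta>\<close>.\<close>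
    have "(\<Sum>y\<in>supp x. w y x *\<^sub>R (x - rep y - v y)) \<in> convex hull {x. nm x < \<eta>0}"
      using v \<eta> w by (intro convex_sum supp_fin convex_convex_hull supp_sum) (force intro: hull_inc)+
    then have "nm (\<Sum>y\<in>supp x. w y x *\<^sub>R (x - rep y - v y)) < \<zeta>'"
      using \<eta>0(2) by blast
    moreover have "(\<Sum>y\<in>supp x. w y x *\<^sub>R (x - rep y - v y)) = x - \<sigma> x - (\<Sum>y\<in>supp x. w y x *\<^sub>R v y)"
      by (simp add: scaleR_diff_right sum_subtractf \<sigma>_def scaleR_left.sum[symmetric] supp_sum)
    moreover have "(\<Sum>y\<in>supp x. w y x *\<^sub>R v y) \<in> L"
      using v by (intro subspace_sum subspace_scale L)
    ultimately show "dst L (x - \<sigma> x) < \<zeta>'"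
      using dst_le[of "\<Sum>y\<in>supp x. w y x *\<^sub>R v y" L "x - \<sigma> x"] by simp
  next
    fix x assume x: "dst L x < \<zeta>"
    \<comment> \<open>One \<open>\<zeta>\<close> each for the distance of \<open>x\<close> to
      \<open>L\<close>, for the radius of the bump around \<open>y\<close>, and for the slack in the
      choice of \<open>rep y\<close>.\<close>
    have "nm (rep y) < 3 * \<zeta>" if "y \<in> supp x" for y
      using rep(2)[of y] dst_triangle3[OF L, of y 0 x] dst_sym[OF L, of x y] supp_near[OF that] x \<eta>
      by simp
    then have "\<sigma> x \<in> convex hull {x. nm x < 3 * \<zeta>}"
      unfolding \<sigma>_def using w
      by (intro convex_sum supp_fin convex_convex_hull supp_sum) (auto intro: hull_inc)
    then show "nm (\<sigma> x) < \<epsilon>"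
      using hull by blast
  qed
qed

text \<open>The Bartle--Graves theorem: a continuous section of the quotient map onto the space modulo
  the closure of \<open>L\<close> amounts to a continuous map \<open>r\<close> into that closure that commutes with
  translations by its elements. Approximate sections are summed as in Michael's selection theorem.\<close>

lemma ex_equivariant_retraction:
  assumes L: "subspace L"
  obtains r where "\<And>X z. cvg X z \<Longrightarrow> cvg (\<lambda>k. r (X k)) (r z)"
    "\<And>x. dst L (r x) = 0" "\<And>x s. dst L s = 0 \<Longrightarrow> r (x + s) = r x + s"
proof -
  \<comment> \<open>Residues at distance less than \<open>\<zeta> n\<close> from \<open>L\<close>
    admit corrections of norm less than \<open>(1/2)^n\<close>, hence summable ones.\<close>
  have "\<exists>\<zeta>. 0 < \<zeta> \<and> \<zeta> \<le> (1/2)^n \<and> convex hull {x. nm x < 3 * \<zeta>} \<subseteq> {x. nm x < (1/2)^n}" for n :: nat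
  proof -
    obtain \<rho> where \<rho>: "\<rho> > 0" "convex hull {x. nm x < \<rho>} \<subseteq> {x. nm x < (1/2)^n}"
      using nm_convex[of "(1/2)^n"] by auto
    define \<zeta> where "\<zeta> = min (\<rho> / 3) ((1/2)^n)"
    have "convex hull {x. nm x < 3 * \<zeta>} \<subseteq> convex hull {x. nm x < \<rho>}"
      by (intro hull_mono) (auto simp: \<zeta>_def)
    then show ?thesis
      using \<rho> by (intro exI[of _ \<zeta>]) (auto simp: \<zeta>_def)
  qed
  then obtain \<zeta> :: "nat \<Rightarrow> real" where \<zeta>: "\<And>n. 0 < \<zeta> n" "\<And>n. \<zeta> n \<le> (1/2)^n"
    "\<And>n. convex hull {x. nm x < 3 * \<zeta> n} \<subseteq> {x. nm x < (1/2)^n}"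
    by metis
  have "\<forall>n. \<exists>\<sigma>. (\<forall>X z. cvg X z \<longrightarrow> cvg (\<lambda>k. \<sigma> (X k)) (\<sigma> z)) \<and>
      (\<forall>x s. dst L s = 0 \<longrightarrow> \<sigma> (x + s) = \<sigma> x) \<and>
      (\<forall>x. dst L (x - \<sigma> x) < \<zeta> (Suc n)) \<and> (\<forall>x. dst L x < \<zeta> n \<longrightarrow> nm (\<sigma> x) < (1/2)^n)"
  proof
    fix n
    obtain \<sigma> where \<sigma>: "\<And>X z. cvg X z \<Longrightarrow> cvg (\<lambda>k. \<sigma> (X k)) (\<sigma> z)"
        "\<And>x s. dst L s = 0 \<Longrightarrow> \<sigma> (x + s) = \<sigma> x"
        "\<And>x. dst L (x - \<sigma> x) < \<zeta> (Suc n)" "\<And>x. dst L x < \<zeta> n \<Longrightarrow> nm (\<sigma> x) < (1/2)^n"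
      by (rule ex_approximate_section[OF L \<zeta>(1)[of n] \<zeta>(1)[of "Suc n"] \<zeta>(3)[of n]]) (rule that)
    show "\<exists>\<sigma>. (\<forall>X z. cvg X z \<longrightarrow> cvg (\<lambda>k. \<sigma> (X k)) (\<sigma> z)) \<and>
      (\<forall>x s. dst L s = 0 \<longrightarrow> \<sigma> (x + s) = \<sigma> x) \<and>
      (\<forall>x. dst L (x - \<sigma> x) < \<zeta> (Suc n)) \<and> (\<forall>x. dst L x < \<zeta> n \<longrightarrow> nm (\<sigma> x) < (1/2)^n)"
      using \<sigma> by (intro exI[of _ \<sigma>]) simp
  qed
  then obtain \<sigma> where \<sigma>: "\<And>n X z. cvg X z \<Longrightarrow> cvg (\<lambda>k. \<sigma> n (X k)) (\<sigma> n z)"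
    "\<And>n x s. dst L s = 0 \<Longrightarrow> \<sigma> n (x + s) = \<sigma> n x"
    "\<And>n x. dst L (x - \<sigma> n x) < \<zeta> (Suc n)" "\<And>n x. dst L x < \<zeta> n \<Longrightarrow> nm (\<sigma> n x) < (1/2)^n"
    by metis
  \<comment> \<open>\<open>q n x\<close> is \<open>x\<close> minus the first \<open>n\<close>
    corrections. Each correction depends only on the coset, so \<open>q n\<close> commutes with
    translations by the closure of \<open>L\<close>, while the distance of \<open>q n x\<close> to
    \<open>L\<close> tends to 0.\<close>
  define q where "q = rec_nat (\<lambda>x. x) (\<lambda>n g x. g x - \<sigma> n (g x))"
  have q: "q 0 x = x" "q (Suc n) x = q n x - \<sigma> n (q n x)" for n x
    by (simp_all add: q_def)
  have q_dst: "dst L (q (Suc n) x) < \<zeta> (Suc n)" for n x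
    unfolding q by (rule \<sigma>(3))
  have q_step: "nm (q (Suc (Suc n)) x - q (Suc n) x) < (1/2)^Suc n" for n x
    using \<sigma>(4)[OF q_dst] by (simp add: q(2)[of "Suc n"])
  have q_cont: "cvg (\<lambda>k. q n (X k)) (q n z)" if "cvg X z" for n X z
    by (induction n) (auto simp: q that intro: cvg_diff \<sigma>(1))
  have q_add: "q n (x + s) = q n x + s" if "dst L s = 0" for n x s
    by (induction n) (simp_all add: q \<sigma>(2)[OF that] diff_add_eq)
  \<comment> \<open>The subtracted term of the geometric sum is what makes the induction close; it
    is dropped afterwards.\<close>
  have q_diff: "nm (q (Suc (n + j)) x - q (Suc n) x) \<le> (1/2)^n - (1/2)^(n + j)" for n j x
  proof (induction j)
    case (Suc j)
    have "nm (q (Suc (n + Suc j)) x - q (Suc n) x)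
        \<le> nm (q (Suc (Suc (n + j))) x - q (Suc (n + j)) x) + nm (q (Suc (n + j)) x - q (Suc n) x)"
      using nm_triangle3 by simp
    also have "\<dots> \<le> (1/2)^Suc (n + j) + ((1/2)^n - (1/2)^(n + j))"
      using q_step[of "n + j" x] Suc.IH by simp
    finally show ?case by simp
  qed simp
  have q_diff': "nm (q (Suc m) x - q (Suc n) x) \<le> (1/2)^n" if "n \<le> m" for m n x
  proof -
    have "nm (q (Suc (n + (m - n))) x - q (Suc n) x) \<le> (1/2)^n - (1/2)^(n + (m - n))"
      by (rule q_diff)
    moreover have "0 \<le> (1/2 :: real)^(n + (m - n))"
      by simp
    ultimately have "nm (q (Suc (n + (m - n))) x - q (Suc n) x) \<le> (1/2)^n"
      by linarith
    then show ?thesis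
      using that by simp
  qed
  have "\<exists>z. (\<lambda>m. nm (q (Suc m) x - z)) \<longlonglongrightarrow> 0" for x
  proof (rule nm_complete)
    fix e :: real assume "e > 0"
    then obtain K where K: "(1/2 :: real)^K < e / 2"
      using real_arch_pow_inv[of "e / 2" "1/2"] by auto
    have "nm (q (Suc m) x - q (Suc n) x) < e" if "m \<ge> K" "n \<ge> K" for m n
      using nm_triangle3[of "q (Suc m) x" "q (Suc n) x" "q (Suc K) x"] nm_sym[of "q (Suc K) x"]
        q_diff'[OF that(1), of x] q_diff'[OF that(2), of x] K by simp
    then show "\<exists>K. \<forall>m\<ge>K. \<forall>n\<ge>K. nm (q (Suc m) x - q (Suc n) x) < e"
      by blast
  qed
  then obtain r where r: "\<And>x. cvg (\<lambda>m. q (Suc m) x) (r x)"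
    unfolding cvg_def by metis
  \<comment> \<open>The bound does not depend on \<open>x\<close>, so \<open>r\<close> is a uniform
    limit and inherits continuity.\<close>
  have r_diff: "nm (r x - q (Suc n) x) \<le> (1/2)^n" for x n
  proof -
    have "(\<lambda>m. nm (q (Suc m) x - r x)) \<longlonglongrightarrow> 0"
      using r by (simp add: cvg_def)
    then have "(\<lambda>m. nm (q (Suc m) x - r x) + (1/2)^n) \<longlonglongrightarrow> 0 + (1/2)^n"
      by (intro tendsto_add tendsto_const)
    moreover have "\<forall>m\<ge>n. nm (r x - q (Suc n) x) \<le> nm (q (Suc m) x - r x) + (1/2)^n"
    proof (intro allI impI)
      fix m assume "n \<le> m"
      then show "nm (r x - q (Suc n) x) \<le> nm (q (Suc m) x - r x) + (1/2)^n"
        using nm_triangle3[of "r x" "q (Suc n) x" "q (Suc m) x"] q_diff'[of n m x]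
          nm_sym[of "r x" "q (Suc m) x"] by linarith
    qed
    ultimately have "nm (r x - q (Suc n) x) \<le> 0 + (1/2)^n"
      by (intro LIMSEQ_le_const) blast+
    then show ?thesis by simp
  qed
  have small: "\<exists>n. (1/2 :: real)^n < e" if "e > 0" for e
    using real_arch_pow_inv[of e "1/2"] that by auto
  show ?thesis
  proof (rule that[of r])
    fix X z assume X: "cvg X z"
    show "cvg (\<lambda>k. r (X k)) (r z)"
      unfolding cvg_def
    proof (rule LIMSEQ_I)
      fix e :: real assume "e > 0"
      then obtain n where n: "(1/2 :: real)^n < e / 4"
        using small[of "e / 4"] by auto
      have "\<forall>\<^sub>F k in sequentially. nm (q (Suc n) (X k) - q (Suc n) z) < e / 4"
        using \<open>e > 0\<close> by (intro cvg_eventually q_cont X) auto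
      then obtain K where K: "\<And>k. k \<ge> K \<Longrightarrow> nm (q (Suc n) (X k) - q (Suc n) z) < e / 4"
        by (auto simp: eventually_sequentially)
      have "nm (r (X k) - r z) < e" if "k \<ge> K" for k
        using K[OF that] r_diff[of "X k" n] r_diff[of z n] n \<open>e > 0\<close>
          nm_sym[of "q (Suc n) z" "r z"]
          nm_triangle3[of "r (X k)" "r z" "q (Suc n) (X k)"]
          nm_triangle3[of "q (Suc n) (X k)" "r z" "q (Suc n) z"]
        by linarith
      then show "\<exists>K. \<forall>k\<ge>K. norm (nm (r (X k) - r z) - 0) < e"
        by auto
    qed
  next
    fix x
    have "dst L (r x) \<le> 0 + e" if e: "e > 0" for e
    proof -
      obtain n where n: "(1/2 :: real)^n < e / 2"
        using small[of "e / 2"] e by auto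
      have "(1/2 :: real)^Suc n \<le> (1/2)^n"
        by (rule power_decreasing) auto
      moreover have "dst L (r x) \<le> dst L (r x - q (Suc n) x) + dst L (q (Suc n) x)"
        using dst_triangle[OF L, of "r x - q (Suc n) x" "q (Suc n) x"] by simp
      ultimately show ?thesis
        using dst_le_nm[OF L, of "r x - q (Suc n) x"] q_dst[of n x] \<zeta>(2)[of "Suc n"] r_diff[of x n] n
        by linarith
    qed
    then show "dst L (r x) = 0"
      by (intro antisym[OF field_le_epsilon dst_nonneg[OF L]])
  next
    fix x s assume s: "dst L s = 0"
    have "nm (r (x + s) - (r x + s)) \<le> 0 + e" if e: "e > 0" for e
    proof -
      obtain n where n: "(1/2 :: real)^n < e / 2"
        using small[of "e / 2"] e by auto
      have "nm (q (Suc n) (x + s) - (r x + s)) = nm (r x - q (Suc n) x)"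
        using nm_sym[of "q (Suc n) x" "r x"] by (simp add: q_add[OF s])
      then show ?thesis
        using r_diff[of "x + s" n] r_diff[of x n] n
          nm_triangle3[of "r (x + s)" "r x + s" "q (Suc n) (x + s)"] by linarith
    qed
    then have "nm (r (x + s) - (r x + s)) \<le> 0"
      by (rule field_le_epsilon)
    then show "r (x + s) = r x + s"
      using nm_nonneg[of "r (x + s) - (r x + s)"] nm_eq_0[of "r (x + s) - (r x + s)"] by simp
  qed
qed

section \<open>Locally finite approximations of the identity\<close>

text \<open>Turns constants that are available locally into a continuous function, by Lipschitz
  regularisation of the largest admissible constant. It serves to choose both
  \<open>\<delta>\<close> and the reciprocal of \<open>m\<close>.\<close>

lemma ex_continuous_minorant:
  assumes P: "\<And>z. z \<in> S \<Longrightarrow> \<exists>s>0. \<exists>\<rho>>0. \<forall>x\<in>S. nm (x - z) < \<rho> \<longrightarrow> P x s"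
    and mono: "\<And>x s t. P x s \<Longrightarrow> 0 < t \<Longrightarrow> t \<le> s \<Longrightarrow> P x t"
  obtains h :: "'a \<Rightarrow> real" where "\<And>x. x \<in> S \<Longrightarrow> 0 < h x" "\<And>x. x \<in> S \<Longrightarrow> h x \<le> 1/2"
    "\<And>x. x \<in> S \<Longrightarrow> P x (h x)"
    "\<And>X z. range X \<subseteq> S \<Longrightarrow> z \<in> S \<Longrightarrow> cvg X z \<Longrightarrow> (\<lambda>k. h (X k)) \<longlonglongrightarrow> h z"
proof -
  define A where "A x = {s. 0 < s \<and> s \<le> 1 \<and> P x s}" for x
  define g where "g x = Sup (A x)" for x
  \<comment> \<open>The infimal convolution of \<open>g\<close> with \<open>nm\<close>, which is the
    largest minorant of \<open>g\<close> on \<open>S\<close> with Lipschitz constant 1.\<close>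
  define i where "i x = (INF y\<in>S. g y + nm (x - y))" for x
  have Abdd: "bdd_above (A x)" for x
    by (rule bdd_aboveI[of _ 1]) (auto simp: A_def)
  have Ane: "A x \<noteq> {}" if x: "x \<in> S" for x
  proof -
    obtain s \<rho> where "s > 0" "\<rho> > 0" "\<forall>y\<in>S. nm (y - x) < \<rho> \<longrightarrow> P y s"
      using P[OF x] by blast
    then have "min s 1 \<in> A x"
      using that mono[of x s "min s 1"] by (auto simp: A_def)
    then show ?thesis by blast
  qed
  have g_ge: "s \<le> g x" if "s \<in> A x" for s x
    unfolding g_def using that Abdd by (rule cSup_upper)
  have g_pos: "0 < g x" if x: "x \<in> S" for x
  proof -
    obtain s where "s \<in> A x"
      using Ane[OF x] by blast
    then show ?thesis
      using g_ge[of s x] by (simp add: A_def)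
  qed
  have g_le: "g x \<le> 1" if "x \<in> S" for x
    unfolding g_def using Ane[OF that] by (rule cSup_least) (auto simp: A_def)
  have g_P: "P x s" if s: "x \<in> S" "0 < s" "s < g x" for x s
  proof -
    obtain t where "t \<in> A x" "s < t"
      using s(3) less_cSup_iff[OF Ane[OF s(1)] Abdd, of s] unfolding g_def by blast
    then show ?thesis
      using mono[of x t s] s by (auto simp: A_def)
  qed
  have ibdd: "bdd_below ((\<lambda>y. g y + nm (x - y)) ` S)" for x
    using g_pos by (intro bdd_belowI2[of _ 0]) (simp add: less_imp_le)
  have i_le: "i x \<le> g y + nm (x - y)" if "y \<in> S" for x y
    unfolding i_def using that by (rule cINF_lower[OF ibdd])
  have i_le_g: "i x \<le> g x" if "x \<in> S" for x
    using i_le[OF that, of x] by simp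
  have i_pos: "0 < i x" if x: "x \<in> S" for x
  proof -
    obtain s \<rho> where s: "s > 0" "\<rho> > 0" "\<forall>y\<in>S. nm (y - x) < \<rho> \<longrightarrow> P y s"
      using P[OF x] by blast
    \<comment> \<open>Near \<open>x\<close> the term \<open>g y\<close> is bounded below, and
      elsewhere \<open>nm (x - y)\<close> is.\<close>
    have "min (min s 1) \<rho> \<le> g y + nm (x - y)" if y: "y \<in> S" for y
    proof (cases "nm (x - y) < \<rho>")
      case True
      then have "min s 1 \<in> A y"
        using s y mono[of y s "min s 1"] nm_sym[of x y] by (auto simp: A_def)
      then show ?thesis
        using g_ge[of "min s 1" y] nm_nonneg[of "x - y"] by linarith
    next
      case False
      then show ?thesis
        using g_pos[OF y] by linarith
    qed
    then have "min (min s 1) \<rho> \<le> i x"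
      unfolding i_def using that by (intro cINF_greatest) auto
    then show ?thesis
      using s by linarith
  qed
  have i_lip: "i x \<le> i z + nm (x - z)" if "x \<in> S" "z \<in> S" for x z
  proof -
    have "i x - nm (x - z) \<le> g y + nm (z - y)" if "y \<in> S" for y
      using i_le[OF that, of x] nm_triangle3[of x y z] by linarith
    then have "i x - nm (x - z) \<le> i z"
      unfolding i_def[of z] using that by (intro cINF_greatest) auto
    then show ?thesis by simp
  qed
  show ?thesis
  \<comment> \<open>Halving moves the value strictly below the supremum \<open>g x\<close>, which
    need not be attained.\<close>
  proof (rule that[of "\<lambda>x. i x / 2"])
    show "0 < i x / 2" "i x / 2 \<le> 1/2" "P x (i x / 2)" if "x \<in> S" for x
      using i_pos[OF that] i_le_g[OF that] g_le[OF that] g_P[OF that, of "i x / 2"] by auto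
    fix X z assume "range X \<subseteq> S" and X: "z \<in> S" "cvg X z"
    then have XS: "X k \<in> S" for k
      by blast
    have lip: "\<bar>i (X k) - i z\<bar> \<le> nm (X k - z)" for k
      using i_lip[OF XS[of k] X(1)] i_lip[OF X(1) XS[of k]] nm_sym[of z "X k"] by linarith
    have "(\<lambda>k. i (X k) - i z) \<longlonglongrightarrow> 0"
      by (rule Lim_null_comparison[OF _ X(2)[unfolded cvg_def]])
        (intro always_eventually allI, simp only: real_norm_def lip)
    then have "(\<lambda>k. i (X k)) \<longlonglongrightarrow> i z"
      by (simp add: LIM_zero_iff)
    then show "(\<lambda>k. i (X k) / 2) \<longlonglongrightarrow> i z / 2"
      by (intro tendsto_divide tendsto_const) auto
  qed
qed

section \<open>The polygonal path through a sequence\<close>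

definition pl_path :: "(nat \<Rightarrow> 'a) \<Rightarrow> real \<Rightarrow> 'a"
  where "pl_path e t = (1 - frac t) *\<^sub>R e (nat \<lfloor>t\<rfloor>) + frac t *\<^sub>R e (Suc (nat \<lfloor>t\<rfloor>))"

text \<open>On bounded time intervals the path is a finite sum with tent functions as coefficients.
  Continuity is visible from this form, unlike from the one with \<open>frac\<close> and the floor
  function.\<close>

lemma pl_path_eq_sum:
  assumes t: "0 \<le> t" "t + 1 < real M"
  shows "pl_path e t = (\<Sum>j<M. max 0 (1 - \<bar>t - real j\<bar>) *\<^sub>R e j)"
proof -
  define m where "m = nat \<lfloor>t\<rfloor>"
  have m: "real m = of_int \<lfloor>t\<rfloor>"
    using t by (simp add: m_def)
  have mt: "real m \<le> t" "t < real m + 1" "frac t = t - real m"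
    unfolding m frac_def by linarith+
  have "Suc m < M"
    using mt t by linarith
  have "(\<Sum>j<M. max 0 (1 - \<bar>t - real j\<bar>) *\<^sub>R e j) = (\<Sum>j\<in>{m, Suc m}. max 0 (1 - \<bar>t - real j\<bar>) *\<^sub>R e j)"
  proof (rule sum.mono_neutral_right)
    show "\<forall>j\<in>{..<M} - {m, Suc m}. max 0 (1 - \<bar>t - real j\<bar>) *\<^sub>R e j = 0"
    proof
      fix j assume "j \<in> {..<M} - {m, Suc m}"
      then have "j + 1 \<le> m \<or> m + 2 \<le> j"
        by auto
      then have "1 - \<bar>t - real j\<bar> \<le> 0"
        using mt(1,2) by linarith
      then show "max 0 (1 - \<bar>t - real j\<bar>) *\<^sub>R e j = 0"
        by simp
    qed
  qed (use \<open>Suc m < M\<close> in auto)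
  also have "\<dots> = pl_path e t"
    using mt(1,2) by (simp add: pl_path_def m_def[symmetric] mt(3) abs_if)
  finally show ?thesis by simp
qed

lemma cvg_pl_path:
  assumes T: "T \<longlonglongrightarrow> t" and T0: "\<And>k. 0 \<le> T k"
  shows "cvg (\<lambda>k. pl_path e (T k)) (pl_path e t)"
proof -
  have t0: "0 \<le> t"
    using T by (rule LIMSEQ_le_const) (use T0 in auto)
  obtain M :: nat where M: "t + 2 < real M"
    using reals_Archimedean2 by blast
  have "\<forall>\<^sub>F k in sequentially. T k < t + 1"
    using order_tendstoD(2)[OF T, of "t + 1"] by simp
  then have "\<forall>\<^sub>F k in sequentially. pl_path e (T k) = (\<Sum>j<M. max 0 (1 - \<bar>T k - real j\<bar>) *\<^sub>R e j)"
    by (rule eventually_mono) (use M T0 in \<open>auto intro: pl_path_eq_sum\<close>)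
  moreover have "cvg (\<lambda>k. \<Sum>j<M. max 0 (1 - \<bar>T k - real j\<bar>) *\<^sub>R e j) (\<Sum>j<M. max 0 (1 - \<bar>t - real j\<bar>) *\<^sub>R e j)"
    by (intro cvg_sum cvg_scaleR cvg_const tendsto_max tendsto_const tendsto_diff tendsto_rabs T)
  moreover have "pl_path e t = (\<Sum>j<M. max 0 (1 - \<bar>t - real j\<bar>) *\<^sub>R e j)"
    using t0 M by (intro pl_path_eq_sum) auto
  ultimately show ?thesis
    using cvg_cong by force
qed

lemma pl_path_bounded:
  assumes e: "\<And>\<eta>. \<eta> > 0 \<Longrightarrow> \<exists>\<tau>>0. \<forall>s n. 0 \<le> s \<longrightarrow> s \<le> \<tau> \<longrightarrow> nm (s *\<^sub>R e n) < \<eta>" and "\<eta> > 0"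
  shows "\<exists>\<tau>>0. \<forall>s t. 0 \<le> s \<longrightarrow> s \<le> \<tau> \<longrightarrow> nm (s *\<^sub>R pl_path e t) < \<eta>"
proof -
  obtain \<tau> where \<tau>: "\<tau> > 0" "\<And>s n. 0 \<le> s \<Longrightarrow> s \<le> \<tau> \<Longrightarrow> nm (s *\<^sub>R e n) < \<eta> / 2"
    using e[of "\<eta> / 2"] \<open>\<eta> > 0\<close> by auto
  have "nm (s *\<^sub>R pl_path e t) < \<eta>" if s: "0 \<le> s" "s \<le> \<tau>" for s t
  proof -
    have fr: "0 \<le> frac t" "frac t \<le> 1"
      using frac_lt_1[of t] by auto
    have "0 \<le> s * (1 - frac t)" "s * (1 - frac t) \<le> s" "0 \<le> s * frac t" "s * frac t \<le> s"
      using s fr by (auto intro: mult_left_le)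
    then have "nm ((s * (1 - frac t)) *\<^sub>R e (nat \<lfloor>t\<rfloor>)) < \<eta> / 2"
        "nm ((s * frac t) *\<^sub>R e (Suc (nat \<lfloor>t\<rfloor>))) < \<eta> / 2"
      using s by - (rule \<tau>(2), linarith, linarith)+
    then show ?thesis
      using nm_triangle[of "(s * (1 - frac t)) *\<^sub>R e (nat \<lfloor>t\<rfloor>)" "(s * frac t) *\<^sub>R e (Suc (nat \<lfloor>t\<rfloor>))"]
      by (simp add: pl_path_def scaleR_add_right)
  qed
  then show ?thesis
    using \<tau>(1) by blast
qed

lemma span_mono_nat:
  fixes e :: "nat \<Rightarrow> 'a"
  shows "m \<le> n \<Longrightarrow> span (e ` {..<m}) \<subseteq> span (e ` {..<n})"
  by (intro span_mono) auto

text \<open>If the weight of the later vertex is at least \<open>\<theta>\<close>, that vertex keeps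
  the point away from the span of its predecessors, the earlier vertex included. Otherwise the
  earlier vertex dominates: the later one disturbs by at most \<open>\<theta> * R\<close>, and
  \<open>\<theta> * (1 + R) = 1 / 2\<close> leaves at least \<open>1 / 2\<close>.\<close>

lemma pl_path_avoids_span:
  assumes p: "cseminorm p" and R: "R > 0" "\<And>n. p (e n) \<le> R"
    and e: "\<And>n v. v \<in> span (e ` {..<n}) \<Longrightarrow> 1 \<le> p (e n - v)"
    and v: "v \<in> span (e ` {..<nat \<lfloor>t\<rfloor>})" and \<theta>: "\<theta> = 1 / (2 * (1 + R))"
  shows "\<theta> \<le> p (pl_path e t - v)"
proof -
  define \<alpha> m where "\<alpha> = frac t" and "m = nat \<lfloor>t\<rfloor>"
  have \<alpha>: "0 \<le> \<alpha>" "\<alpha> < 1"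
    using frac_lt_1[of t] by (auto simp: \<alpha>_def)
  have \<theta>': "0 < \<theta>" "\<theta> * (1 + R) = 1 / 2" "\<theta> \<le> 1 / 2"
    using R(1) by (auto simp: \<theta> field_simps)
  have psc: "p (c *\<^sub>R x) = \<bar>c\<bar> * p x" and padd: "p (x + y) \<le> p x + p y" for c x y
    using p by (auto simp: cseminorm_def)
  have v': "v \<in> span (e ` {..<m})"
    using v by (simp add: m_def)
  show ?thesis
  proof (cases "\<theta> \<le> \<alpha>")
    case True
    define v1 where "v1 = (1 / \<alpha>) *\<^sub>R (v - (1 - \<alpha>) *\<^sub>R e m)"
    have "v1 \<in> span (e ` {..<Suc m})"
      unfolding v1_def using v' span_mono_nat[of m "Suc m" e]
      by (intro span_scale span_diff) (auto intro: span_base)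
    then have "\<alpha> * 1 \<le> \<alpha> * p (e (Suc m) - v1)"
      using \<alpha> by (intro mult_left_mono e) auto
    also have "\<dots> = p (\<alpha> *\<^sub>R (e (Suc m) - v1))"
      using \<alpha> by (simp add: psc)
    also have "\<alpha> *\<^sub>R (e (Suc m) - v1) = pl_path e t - v"
      using True \<theta>' by (simp add: v1_def pl_path_def \<alpha>_def[symmetric] m_def[symmetric] algebra_simps)
    finally show ?thesis using True by simp
  next
    case False
    define v1 where "v1 = (1 / (1 - \<alpha>)) *\<^sub>R v"
    have "v1 \<in> span (e ` {..<m})"
      unfolding v1_def using v' by (rule span_scale)
    then have "(1 - \<alpha>) * 1 \<le> (1 - \<alpha>) * p (e m - v1)"
      using \<alpha> by (intro mult_left_mono e) auto
    also have "\<dots> = p ((1 - \<alpha>) *\<^sub>R (e m - v1))"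
      using \<alpha> by (simp add: psc)
    also have "(1 - \<alpha>) *\<^sub>R (e m - v1) = (pl_path e t - v) + (- \<alpha>) *\<^sub>R e (Suc m)"
      using \<alpha> by (simp add: v1_def pl_path_def \<alpha>_def[symmetric] m_def[symmetric] scaleR_diff_right)
    also have "p \<dots> \<le> p (pl_path e t - v) + p ((- \<alpha>) *\<^sub>R e (Suc m))"
      by (rule padd)
    also have "p ((- \<alpha>) *\<^sub>R e (Suc m)) \<le> \<alpha> * R"
      unfolding psc using \<alpha> R(2)[of "Suc m"] by (simp add: mult_left_mono)
    finally have "1 - \<alpha> * (1 + R) \<le> p (pl_path e t - v)"
      by (simp add: algebra_simps)
    moreover have "\<alpha> * (1 + R) \<le> \<theta> * (1 + R)"
      using False R(1) by (intro mult_right_mono) auto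
    ultimately show ?thesis
      using \<theta>' by linarith
  qed
qed

lemma span_range_nat:
  fixes e :: "nat \<Rightarrow> 'a"
  assumes "v \<in> span (range e)" shows "\<exists>J. v \<in> span (e ` {..<J})"
  using assms
proof (induction rule: span_induct_alt)
  case base
  then show ?case by (blast intro: span_zero)
next
  case (step c x y)
  then obtain i J where iJ: "x = e i" "y \<in> span (e ` {..<J})"
    by auto
  have "x \<in> span (e ` {..<max J (Suc i)})"
    using iJ by (intro span_base) auto
  moreover have "y \<in> span (e ` {..<max J (Suc i)})"
    using iJ span_mono_nat[of J "max J (Suc i)" e] by auto
  ultimately show ?case
    by (blast intro: span_add span_scale)
qed

section \<open>The approximating maps\<close>

lemma convex_locally_finite_approximation:
  assumes C: "convex C" and A: "A \<subseteq> C" "uncountable A" and \<epsilon>: "\<epsilon> > 0"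
    and sep: "\<And>a a'. a \<in> A \<Longrightarrow> a' \<in> A \<Longrightarrow> a \<noteq> a' \<Longrightarrow> \<epsilon> \<le> nm (a - a')"
    and cover: "\<And>x. x \<in> C \<Longrightarrow> \<exists>U\<in>\<U>. x \<in> U"
    and opn: "\<And>U x. U \<in> \<U> \<Longrightarrow> x \<in> U \<Longrightarrow> x \<in> C \<Longrightarrow> \<exists>\<rho>>0. \<forall>y\<in>C. nm (y - x) < \<rho> \<longrightarrow> y \<in> U"
  obtains f :: "nat \<Rightarrow> 'a \<Rightarrow> 'a"
  where "\<And>n x. x \<in> C \<Longrightarrow> f n x \<in> C"
    "\<And>n X z. range X \<subseteq> C \<Longrightarrow> z \<in> C \<Longrightarrow> cvg X z \<Longrightarrow> cvg (\<lambda>k. f n (X k)) (f n z)"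
    "\<And>n x. x \<in> C \<Longrightarrow> \<exists>U\<in>\<U>. x \<in> U \<and> f n x \<in> U"
    "\<And>w. w \<in> C \<Longrightarrow> \<exists>\<rho>>0. finite {n. \<exists>x\<in>C. nm (f n x - w) < \<rho>}"
proof -
  \<comment> \<open>A base point: the vectors \<open>e n\<close> will be differences
    \<open>a - b\<close>, so that \<open>b + e n\<close> lies in \<open>C\<close>.\<close>
  obtain b where b: "b \<in> A"
    using A(2) by fastforce
  obtain p0 where p0: "cseminorm p0" "\<And>x. p0 x < 1 \<Longrightarrow> nm x < \<epsilon>"
    using ex_cseminorm[OF \<epsilon>] by blast
  \<comment> \<open>The factor 4 turns \<open>\<epsilon>\<close>-separation in \<open>nm\<close>
    into the 4-separation in \<open>p\<close> that the choice of the sequence asks for.\<close>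
  define p where "p x = 4 * p0 x" for x
  have p: "cseminorm p"
    unfolding p_def using p0(1) by (rule cseminorm_cmul) simp
  have psc: "p (c *\<^sub>R x) = \<bar>c\<bar> * p x" for c x
    using p by (auto simp: cseminorm_def)
  have pcont: "\<exists>\<rho>>0. \<forall>x. nm x < \<rho> \<longrightarrow> p x < \<eta>" if "\<eta> > 0" for \<eta>
    using p that by (auto simp: cseminorm_def)
  have uncA: "uncountable ((\<lambda>a. a - b) ` A)"
  proof
    assume "countable ((\<lambda>a. a - b) ` A)"
    then have "countable A"
      by (rule countable_image_inj_on) (auto simp: inj_on_def)
    then show False using A(2) by simp
  qed
  have sepA: "4 \<le> p (c - c')" if c: "c \<in> (\<lambda>a. a - b) ` A" "c' \<in> (\<lambda>a. a - b) ` A" "c \<noteq> c'" for c c'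
  proof -
    obtain a a' where a: "a \<in> A" "a' \<in> A" "c = a - b" "c' = a' - b"
      using c by blast
    then have "\<epsilon> \<le> nm (c - c')"
      using sep[of a a'] c(3) by auto
    then have "1 \<le> p0 (c - c')"
      using p0(2)[of "c - c'"] by linarith
    then show ?thesis by (simp add: p_def)
  qed
  obtain e :: "nat \<Rightarrow> 'a" where eA: "\<And>n. e n \<in> (\<lambda>a. a - b) ` A"
    and ebd: "\<And>\<eta>. \<eta> > 0 \<Longrightarrow> \<exists>t>0. \<forall>s n. 0 \<le> s \<longrightarrow> s \<le> t \<longrightarrow> nm (s *\<^sub>R e n) < \<eta>"
    and efar: "\<And>n v. v \<in> span (e ` {..<n}) \<Longrightarrow> 1 \<le> p (e n - v)"
    by (rule ex_bounded_separated_sequence[OF uncA p sepA], assumption+) (rule that)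
  define K where "K = pl_path e"
  have eC: "b + e n \<in> C" for n
    using eA[of n] A(1) by auto
  have KC: "b + K t \<in> C" for t
  proof -
    have "(1 - frac t) *\<^sub>R (b + e (nat \<lfloor>t\<rfloor>)) + frac t *\<^sub>R (b + e (Suc (nat \<lfloor>t\<rfloor>))) \<in> C"
      using frac_lt_1[of t] by (intro convexD[OF C] eC) auto
    then show ?thesis
      by (simp add: K_def pl_path_def algebra_simps)
  qed
  have Kbd: "\<exists>\<tau>>0. \<forall>s t. 0 \<le> s \<longrightarrow> s \<le> \<tau> \<longrightarrow> nm (s *\<^sub>R K t) < \<eta>" if "\<eta> > 0" for \<eta>
    unfolding K_def using ebd that by (rule pl_path_bounded)
  obtain R where R: "R > 0" "\<And>n. p (e n) \<le> R"
  proof -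
    obtain \<rho> where \<rho>: "\<rho> > 0" "\<And>x. nm x < \<rho> \<Longrightarrow> p x < 1"
      using pcont[of 1] by auto
    obtain t where t: "t > 0" "\<And>s n. 0 \<le> s \<Longrightarrow> s \<le> t \<Longrightarrow> nm (s *\<^sub>R e n) < \<rho>"
      using ebd[OF \<rho>(1)] by blast
    have "p (t *\<^sub>R e n) < 1" for n
      using \<rho>(2) t by simp
    then have "p (e n) \<le> 1 / t" for n
      using t(1) by (simp add: psc field_simps less_imp_le)
    then show ?thesis
      using that[of "1 / t"] t(1) by simp
  qed
  define \<theta> where "\<theta> = 1 / (2 * (1 + R))"
  have \<theta>: "\<theta> > 0"
    using R(1) by (simp add: \<theta>_def)
  have Kfar: "\<delta> * \<theta> \<le> p (\<delta> *\<^sub>R K t - v)" if "\<delta> > 0" "v \<in> span (e ` {..<nat \<lfloor>t\<rfloor>})" for \<delta> t v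
  proof -
    have "\<theta> \<le> p (K t - (1 / \<delta>) *\<^sub>R v)"
      unfolding K_def using that
      by (intro pl_path_avoids_span[OF p R efar _ \<theta>_def] span_scale) auto
    then have "\<delta> * \<theta> \<le> p (\<delta> *\<^sub>R (K t - (1 / \<delta>) *\<^sub>R v))"
      using that(1) by (simp add: psc)
    then show ?thesis
      using that(1) by (simp add: scaleR_diff_right)
  qed
  define L where "L = span (range e)"
  have L: "subspace L"
    by (simp add: L_def)
  have KL: "K t \<in> L" for t
    unfolding K_def pl_path_def L_def by (intro span_add span_scale span_base) auto
  obtain r where rcont: "\<And>X z. cvg X z \<Longrightarrow> cvg (\<lambda>k. r (X k)) (r z)"
    and rL: "\<And>x. dst L (r x) = 0" and radd: "\<And>x s. dst L s = 0 \<Longrightarrow> r (x + s) = r x + s"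
    by (rule ex_equivariant_retraction[OF L]) (rule that)
  \<comment> \<open>Demanding this for all path parameters \<open>t\<close> allows
    \<open>\<delta>\<close> to be chosen before \<open>m\<close> and independently of
    \<open>n\<close>.\<close>
  define P where "P x s \<longleftrightarrow> (\<forall>\<sigma> t. 0 \<le> \<sigma> \<longrightarrow> \<sigma> \<le> s \<longrightarrow>
    (\<exists>U\<in>\<U>. x \<in> U \<and> (1 - \<sigma>) *\<^sub>R x + \<sigma> *\<^sub>R (b + K t) \<in> U))" for x s
  have Ploc: "\<exists>s>0. \<exists>\<rho>>0. \<forall>x\<in>C. nm (x - z) < \<rho> \<longrightarrow> P x s" if z: "z \<in> C" for z
  proof -
    obtain U \<rho>0 where U: "U \<in> \<U>" "\<rho>0 > 0" "\<And>y. y \<in> C \<Longrightarrow> nm (y - z) < \<rho>0 \<Longrightarrow> y \<in> U"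
      using cover[OF z] opn[OF _ _ z] by metis
    \<comment> \<open>The displacement \<open>y - z\<close> will be split into five terms, each of
      norm less than a fifth of \<open>\<rho>0\<close>.\<close>
    have \<rho>5: "\<rho>0 / 5 > 0"
      using U(2) by simp
    obtain \<rho>1 where \<rho>1: "\<rho>1 > 0" "\<And>s y. 0 \<le> s \<Longrightarrow> s \<le> 1 \<Longrightarrow> nm y < \<rho>1 \<Longrightarrow> nm (s *\<^sub>R y) < \<rho>0 / 5"
      using nm_scaleR_ball[OF \<rho>5] by blast
    obtain t1 where t1: "t1 > 0" "\<And>s. 0 \<le> s \<Longrightarrow> s \<le> t1 \<Longrightarrow> nm (s *\<^sub>R b) < \<rho>0 / 5"
      using nm_scaleR_small[OF \<rho>5] by blast
    obtain t2 where t2: "t2 > 0" "\<And>s. 0 \<le> s \<Longrightarrow> s \<le> t2 \<Longrightarrow> nm (s *\<^sub>R z) < \<rho>0 / 5"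
      using nm_scaleR_small[OF \<rho>5] by blast
    obtain t3 where t3: "t3 > 0" "\<And>s t. 0 \<le> s \<Longrightarrow> s \<le> t3 \<Longrightarrow> nm (s *\<^sub>R K t) < \<rho>0 / 5"
      using Kbd[OF \<rho>5] by blast
    define s0 \<rho> where "s0 = min (min t1 t2) (min t3 1)" and "\<rho> = min \<rho>1 (\<rho>0 / 5)"
    have "P x s0" if x: "x \<in> C" "nm (x - z) < \<rho>" for x
      unfolding P_def
    proof (intro allI impI)
      fix \<sigma> t assume \<sigma>: "0 \<le> \<sigma>" "\<sigma> \<le> s0"
      define y where "y = (1 - \<sigma>) *\<^sub>R x + \<sigma> *\<^sub>R (b + K t)"
      have "y \<in> C"
        unfolding y_def using \<sigma> by (intro convexD[OF C] x KC) (auto simp: s0_def)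
      have y: "y - z = ((x - z) - \<sigma> *\<^sub>R (x - z)) + (\<sigma> *\<^sub>R b - \<sigma> *\<^sub>R z) + \<sigma> *\<^sub>R K t"
        by (simp add: y_def algebra_simps)
      have "nm (y - z) \<le> (nm (x - z) + nm (\<sigma> *\<^sub>R (x - z))) + (nm (\<sigma> *\<^sub>R b) + nm (\<sigma> *\<^sub>R z)) + nm (\<sigma> *\<^sub>R K t)"
        unfolding y by (meson add_mono nm_triangle nm_triangle_sub order_refl order_trans)
      also have "\<dots> < \<rho>0"
        using \<rho>1(2)[of \<sigma> "x - z"] t1(2)[of \<sigma>] t2(2)[of \<sigma>] t3(2)[of \<sigma> t] \<sigma> x(2)
        by (simp add: s0_def \<rho>_def)
      finally have "y \<in> U"
        using U(3) \<open>y \<in> C\<close> by blast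
      moreover have "x \<in> U"
        using U(2,3) x by (simp add: \<rho>_def)
      ultimately show "\<exists>U\<in>\<U>. x \<in> U \<and> (1 - \<sigma>) *\<^sub>R x + \<sigma> *\<^sub>R (b + K t) \<in> U"
        using U(1) unfolding y_def by blast
    qed
    moreover have "s0 > 0" "\<rho> > 0"
      using t1 t2 t3 \<rho>1 U(2) by (auto simp: s0_def \<rho>_def)
    ultimately show ?thesis by blast
  qed
  have Pmono: "P x t" if "P x s" "0 < t" "t \<le> s" for x s t
    using that unfolding P_def by (meson order_trans)
  obtain \<delta> :: "'a \<Rightarrow> real" where \<delta>: "\<And>x. x \<in> C \<Longrightarrow> 0 < \<delta> x" "\<And>x. x \<in> C \<Longrightarrow> \<delta> x \<le> 1/2"
    and \<delta>P: "\<And>x. x \<in> C \<Longrightarrow> P x (\<delta> x)"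
    and \<delta>cont: "\<And>X z. range X \<subseteq> C \<Longrightarrow> z \<in> C \<Longrightarrow> cvg X z \<Longrightarrow> (\<lambda>k. \<delta> (X k)) \<longlonglongrightarrow> \<delta> z"
    by (rule ex_continuous_minorant[of C P, OF Ploc Pmono], assumption+) (rule that)
  define u where "u x = r ((1 - \<delta> x) *\<^sub>R x + \<delta> x *\<^sub>R b)" for x
  have ucont: "cvg (\<lambda>k. u (X k)) (u z)" if "range X \<subseteq> C" "z \<in> C" "cvg X z" for X z
    unfolding u_def using that
    by (intro rcont cvg_add cvg_scaleR tendsto_diff tendsto_const \<delta>cont cvg_const) auto
  \<comment> \<open>\<open>1 / s\<close> plays the role of \<open>m x\<close>: from this level on,
    the spans contain vectors close to \<open>u x\<close> relative to \<open>\<delta> x\<close>. The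
    reciprocal turns a lower bound on levels into an upper bound on \<open>s\<close>, as required
    for a minorant.\<close>
  define Q where "Q x s \<longleftrightarrow> (\<forall>j::nat. 1 / s \<le> real j \<longrightarrow>
    (\<exists>v\<in>span (e ` {..<j}). p (u x - v) < \<delta> x * \<theta> / 2))" for x s
  have approx: "\<exists>J v. v \<in> span (e ` {..<J}) \<and> p (r x - v) < \<eta>" if \<eta>: "\<eta> > 0" for x \<eta>
  proof -
    obtain \<rho> where \<rho>: "\<rho> > 0" "\<And>x. nm x < \<rho> \<Longrightarrow> p x < \<eta>"
      using pcont[OF \<eta>] by blast
    obtain v where "v \<in> L" "nm (r x - v) < \<rho>"
      using dst_lessD[OF L, of "r x" \<rho>] rL[of x] \<rho>(1) by auto
    then show ?thesis
      using \<rho>(2) span_range_nat[of v e] unfolding L_def by blast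
  qed
  have Qloc: "\<exists>s>0. \<exists>\<rho>>0. \<forall>x\<in>C. nm (x - z) < \<rho> \<longrightarrow> Q x s" if z: "z \<in> C" for z
  proof -
    have \<eta>: "\<delta> z * \<theta> / 8 > 0"
      using \<delta>(1)[OF z] \<theta> by simp
    obtain J v where v: "v \<in> span (e ` {..<J})" "p (u z - v) < \<delta> z * \<theta> / 8"
      using approx[OF \<eta>] unfolding u_def by blast
    obtain \<rho>1 where \<rho>1: "\<rho>1 > 0" "\<And>x. nm x < \<rho>1 \<Longrightarrow> p x < \<delta> z * \<theta> / 8"
      using pcont[OF \<eta>] by blast
    have "\<exists>\<rho>>0. \<forall>x\<in>C. nm (x - z) < \<rho> \<longrightarrow> nm (u x - u z) < \<rho>1"
      using ucont z \<rho>1(1) unfolding cvg_def[of "\<lambda>k. u _"]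
      by (intro sequential_small[of C z "\<lambda>x. nm (u x - u z)" 0]) (auto simp: cvg_def)
    then obtain \<rho>2 where \<rho>2: "\<rho>2 > 0" "\<And>x. x \<in> C \<Longrightarrow> nm (x - z) < \<rho>2 \<Longrightarrow> nm (u x - u z) < \<rho>1"
      by blast
    \<comment> \<open>A lower bound \<open>\<delta> z / 2\<close> for \<open>\<delta>\<close> near
      \<open>z\<close>, obtained from the upper bound for \<open>- \<delta>\<close>.\<close>
    have "\<exists>\<rho>>0. \<forall>x\<in>C. nm (x - z) < \<rho> \<longrightarrow> - \<delta> x < - \<delta> z / 2"
      using z \<delta>(1)[OF z]
      by (intro sequential_small[of C z "\<lambda>x. - \<delta> x" "- \<delta> z"]) (auto intro!: tendsto_minus \<delta>cont)
    then obtain \<rho>3 where \<rho>3: "\<rho>3 > 0" "\<And>x. x \<in> C \<Longrightarrow> nm (x - z) < \<rho>3 \<Longrightarrow> - \<delta> x < - \<delta> z / 2"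
      by blast
    have "Q x (1 / (real J + 1))" if x: "x \<in> C" "nm (x - z) < min \<rho>2 \<rho>3" for x
      unfolding Q_def
    proof (intro allI impI)
      fix j :: nat assume "1 / (1 / (real J + 1)) \<le> real j"
      then have "v \<in> span (e ` {..<j})"
        using v(1) span_mono_nat[of J j e] by auto
      moreover have "nm (u x - u z) < \<rho>1"
        using \<rho>2(2) x by simp
      then have "p (u x - v) < \<delta> z * \<theta> / 8 + \<delta> z * \<theta> / 8"
        using cseminorm_triangle3[OF p, of "u x" v "u z"] \<rho>1(2)[of "u x - u z"] v(2) by linarith
      moreover have "\<delta> z * \<theta> / 2 \<le> \<delta> x * \<theta>"
        using \<rho>3(2)[of x] x mult_right_mono[of "\<delta> z / 2" "\<delta> x" \<theta>] \<theta> by auto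
      ultimately have "v \<in> span (e ` {..<j}) \<and> p (u x - v) < \<delta> x * \<theta> / 2"
        by linarith
      then show "\<exists>v\<in>span (e ` {..<j}). p (u x - v) < \<delta> x * \<theta> / 2"
        by blast
    qed
    then show ?thesis
      using \<rho>2(1) \<rho>3(1) by (intro exI[of _ "1 / (real J + 1)"] conjI exI[of _ "min \<rho>2 \<rho>3"]) auto
  qed
  have Qmono: "Q x t" if "Q x s" "0 < t" "t \<le> s" for x s t
  proof -
    have "1 / s \<le> 1 / t"
      using that by (intro divide_left_mono) auto
    then show ?thesis
      using that(1) unfolding Q_def by (meson order_trans)
  qed
  obtain h :: "'a \<Rightarrow> real" where h: "\<And>x. x \<in> C \<Longrightarrow> 0 < h x" "\<And>x. x \<in> C \<Longrightarrow> h x \<le> 1/2"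
    and hQ: "\<And>x. x \<in> C \<Longrightarrow> Q x (h x)"
    and hcont: "\<And>X z. range X \<subseteq> C \<Longrightarrow> z \<in> C \<Longrightarrow> cvg X z \<Longrightarrow> (\<lambda>k. h (X k)) \<longlonglongrightarrow> h z"
    by (rule ex_continuous_minorant[of C Q, OF Qloc Qmono], assumption+) (rule that)
  \<comment> \<open>The added 1 compensates the rounding, so that the floor of \<open>T n x\<close>
    is still at least \<open>1 / h x\<close>.\<close>
  define T where "T n x = max (real n) (1 / h x + 1)" for n x
  define f where "f n x = (1 - \<delta> x) *\<^sub>R x + \<delta> x *\<^sub>R (b + K (T n x))" for n x
  have T0: "0 \<le> T n x" for n x
    by (simp add: T_def le_max_iff_disj)
  have floor_T: "n \<le> nat \<lfloor>T n x\<rfloor>" "1 / h x \<le> real (nat \<lfloor>T n x\<rfloor>)" for n x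
  proof -
    have "real n \<le> T n x" "1 / h x + 1 \<le> T n x"
      by (auto simp: T_def)
    then show "n \<le> nat \<lfloor>T n x\<rfloor>" "1 / h x \<le> real (nat \<lfloor>T n x\<rfloor>)"
      by linarith+
  qed
  \<comment> \<open>The path lies in \<open>L\<close>, so equivariance of \<open>r\<close> pulls its
    contribution out unchanged.\<close>
  have rf: "r (f n x) = u x + \<delta> x *\<^sub>R K (T n x)" for n x
  proof -
    have "f n x = ((1 - \<delta> x) *\<^sub>R x + \<delta> x *\<^sub>R b) + \<delta> x *\<^sub>R K (T n x)"
      by (simp add: f_def algebra_simps)
    moreover have "dst L (\<delta> x *\<^sub>R K (T n x)) = 0"
      by (intro dst_mem L subspace_scale KL)
    ultimately show ?thesis
      using radd by (simp add: u_def)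
  qed
  \<comment> \<open>The sequential form of a failure of local finiteness at \<open>w\<close>. It is
    contradictory because \<open>\<delta> (X k)\<close> would tend both to 0 and to
    \<open>\<delta> w > 0\<close>.\<close>
  have locfin: False if w: "w \<in> C" and NX: "\<And>k. k \<le> N k" "\<And>k. X k \<in> C"
    and lim: "cvg (\<lambda>k. f (N k) (X k)) w" for w N X
  proof -
    have \<delta>lim: "(\<lambda>k. \<delta> (X k)) \<longlonglongrightarrow> 0"
    proof (rule LIMSEQ_I)
      fix c :: real assume c: "c > 0"
      have \<eta>: "c * \<theta> / 4 > 0"
        using c \<theta> by simp
      obtain J v where v: "v \<in> span (e ` {..<J})" "p (r w - v) < c * \<theta> / 4"
        using approx[OF \<eta>] by blast
      obtain \<rho> where \<rho>: "\<rho> > 0" "\<And>x. nm x < \<rho> \<Longrightarrow> p x < c * \<theta> / 4"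
        using pcont[OF \<eta>] by blast
      obtain k0 where k0: "\<And>k. k0 \<le> k \<Longrightarrow> nm (r (f (N k) (X k)) - r w) < \<rho>"
        using cvg_eventually[OF rcont[OF lim] \<rho>(1)] by (auto simp: eventually_sequentially)
      have "\<delta> (X k) < c" if k: "max J k0 \<le> k" for k
      proof -
        define M t where "M = nat \<lfloor>T (N k) (X k)\<rfloor>" and "t = T (N k) (X k)"
        have "J \<le> M"
          using k NX(1)[of k] floor_T(1)[of "N k" "X k"] by (simp add: M_def)
        then have vM: "v \<in> span (e ` {..<M})"
          using v(1) span_mono_nat[of J M e] by blast
        obtain v0 where v0: "v0 \<in> span (e ` {..<M})" "p (u (X k) - v0) < \<delta> (X k) * \<theta> / 2"
          using hQ[OF NX(2)[of k]] floor_T(2)[of "X k" "N k"] unfolding Q_def M_def by blast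
        have near: "p (r (f (N k) (X k)) - r w) < c * \<theta> / 4"
          using \<rho>(2) k0 k by simp
        \<comment> \<open>Both \<open>v\<close> and \<open>v0\<close> lie in the span of the vectors
          before the current vertex. The error at \<open>v\<close> stays below
          \<open>c * \<theta> / 2\<close>, and the one at \<open>v0\<close> is less than half of the
          left-hand side and is absorbed there.\<close>
        have "\<delta> (X k) * \<theta> \<le> p (\<delta> (X k) *\<^sub>R K t - (v - v0))"
          using vM v0 by (intro Kfar \<delta> NX span_diff) (simp_all add: M_def t_def)
        also have "\<delta> (X k) *\<^sub>R K t - (v - v0) = (r (f (N k) (X k)) - v) - (u (X k) - v0)"
          by (simp add: rf t_def algebra_simps)
        also have "p \<dots> \<le> p (r (f (N k) (X k)) - v) + p (u (X k) - v0)"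
          using cseminorm_triangle3[OF p, of "r (f (N k) (X k)) - v" "u (X k) - v0" 0]
            cseminorm_minus[OF p, of 0 "u (X k) - v0"] by simp
        also have "p (r (f (N k) (X k)) - v) < c * \<theta> / 4 + c * \<theta> / 4"
          using cseminorm_triangle3[OF p, of "r (f (N k) (X k))" v "r w"] v(2) near
          by linarith
        finally have "\<delta> (X k) * \<theta> < c * \<theta>"
          using v0(2) by linarith
        then show ?thesis
          using \<theta> by simp
      qed
      then show "\<exists>k0. \<forall>k\<ge>k0. norm (\<delta> (X k) - 0) < c"
        using \<delta>(1)[OF NX(2)] by (intro exI[of _ "max J k0"]) (simp add: less_imp_le)
    qed
    \<comment> \<open>The parameters of the path run off to infinity, so this convergence rests on
      the boundedness of the whole path.\<close>
    have "cvg (\<lambda>k. \<delta> (X k) *\<^sub>R K (T (N k) (X k))) 0"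
      unfolding cvg_def
    proof (rule LIMSEQ_I)
      fix \<eta> :: real assume "\<eta> > 0"
      then obtain \<tau> where \<tau>: "\<tau> > 0" "\<And>s t. 0 \<le> s \<Longrightarrow> s \<le> \<tau> \<Longrightarrow> nm (s *\<^sub>R K t) < \<eta>"
        using Kbd by blast
      obtain k0 where "\<And>k. k \<ge> k0 \<Longrightarrow> \<delta> (X k) < \<tau>"
        using order_tendstoD(2)[OF \<delta>lim \<tau>(1)] by (auto simp: eventually_sequentially)
      then show "\<exists>k0. \<forall>k\<ge>k0. norm (nm (\<delta> (X k) *\<^sub>R K (T (N k) (X k)) - 0) - 0) < \<eta>"
        using \<tau>(2) \<delta>(1)[OF NX(2)] by (intro exI[of _ k0]) (auto simp: less_imp_le)
    qed
    moreover have "cvg (\<lambda>k. \<delta> (X k) *\<^sub>R b) (0 *\<^sub>R b)"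
      by (intro cvg_scaleR \<delta>lim cvg_const)
    ultimately have "cvg (\<lambda>k. f (N k) (X k) - \<delta> (X k) *\<^sub>R b - \<delta> (X k) *\<^sub>R K (T (N k) (X k))) (w - 0 *\<^sub>R b - 0)"
      by (intro cvg_diff lim)
    then have lim1: "cvg (\<lambda>k. (1 - \<delta> (X k)) *\<^sub>R X k) w"
      by (simp add: f_def scaleR_add_right)
    \<comment> \<open>Dividing by \<open>1 - \<delta> (X k)\<close>, which is at least
      \<open>1/2\<close> and tends to 1, recovers \<open>X k\<close> itself.\<close>
    have "(\<lambda>k. 1 / (1 - \<delta> (X k))) \<longlonglongrightarrow> 1 / (1 - 0)"
      by (intro tendsto_divide tendsto_diff tendsto_const \<delta>lim) simp
    from cvg_scaleR[OF this lim1] have "cvg (\<lambda>k. (1 / (1 - \<delta> (X k))) *\<^sub>R ((1 - \<delta> (X k)) *\<^sub>R X k)) w"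
      by simp
    moreover have "(1 / (1 - \<delta> (X k))) *\<^sub>R ((1 - \<delta> (X k)) *\<^sub>R X k) = X k" for k
      using \<delta>(2)[OF NX(2)[of k]] by simp
    ultimately have "cvg X w"
      by simp
    then have "(\<lambda>k. \<delta> (X k)) \<longlonglongrightarrow> \<delta> w"
      using NX(2) w by (intro \<delta>cont) auto
    then have "\<delta> w = 0"
      using \<delta>lim by (rule LIMSEQ_unique)
    then show False
      using \<delta>(1)[OF w] by simp
  qed
  show ?thesis
  proof (rule that[of f])
    show "f n x \<in> C" if "x \<in> C" for n x
      unfolding f_def using \<delta>(1,2)[OF that] by (intro convexD[OF C] that KC) auto
    show "\<exists>U\<in>\<U>. x \<in> U \<and> f n x \<in> U" if "x \<in> C" for n x
      using \<delta>P[OF that] \<delta>(1)[OF that] unfolding P_def f_def by simp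
    show "cvg (\<lambda>k. f n (X k)) (f n z)" if X: "range X \<subseteq> C" "z \<in> C" "cvg X z" for n X z
    proof -
      have "(\<lambda>k. T n (X k)) \<longlonglongrightarrow> T n z"
        unfolding T_def using X h(1)[OF X(2)]
        by (intro tendsto_max tendsto_add tendsto_divide tendsto_const hcont) auto
      then have "cvg (\<lambda>k. K (T n (X k))) (K (T n z))"
        unfolding K_def using T0 by (intro cvg_pl_path)
      then show ?thesis
        unfolding f_def using X
        by (intro cvg_add cvg_scaleR tendsto_diff tendsto_const \<delta>cont cvg_const) auto
    qed
    fix w assume w: "w \<in> C"
    show "\<exists>\<rho>>0. finite {n. \<exists>x\<in>C. nm (f n x - w) < \<rho>}"
    proof (rule ccontr)
      assume "\<not> ?thesis"
      then have "infinite {n. \<exists>x\<in>C. nm (f n x - w) < \<rho>}" if "\<rho> > 0" for \<rho>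
        using that by blast
      \<comment> \<open>Infinitely many indices for every radius permit a choice with
        \<open>n \<ge> k\<close>, which makes the indices tend to infinity.\<close>
      then have "\<exists>n\<ge>k. n \<in> {n. \<exists>x\<in>C. nm (f n x - w) < 1 / (real k + 1)}" for k :: nat
        unfolding infinite_nat_iff_unbounded_le by simp
      then have "\<forall>k. \<exists>n x. k \<le> n \<and> x \<in> C \<and> nm (f n x - w) < 1 / (real k + 1)"
        by blast
      then obtain N X where NX: "\<And>k. k \<le> N k" "\<And>k. X k \<in> C"
          "\<And>k. nm (f (N k) (X k) - w) < 1 / (real k + 1)"
        by metis
      have "(\<lambda>k. 1 / (real k + 1)) \<longlonglongrightarrow> 0"
        using LIMSEQ_inverse_real_of_nat by (simp add: inverse_eq_divide add.commute)
      then have "cvg (\<lambda>k. f (N k) (X k)) w"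
        by (rule cvg_squeeze) (simp add: NX(3) less_imp_le)
      then show False
        using locfin[of w N X] w NX(1,2) by blast
    qed
  qed
qed

end

section \<open>Transfer to Frechet metrics\<close>

lemma frechet_metric_diff:
  assumes "frechet_metric d" shows "d x y = d (x - y) 0"
proof -
  have "d ((x - y) + y) (0 + y) = d (x - y) 0"
    using assms unfolding frechet_metric_def by blast
  then show ?thesis by simp
qed

text \<open>Translation invariance lets \<open>d x 0\<close> determine the metric, and topological
  limits become null sequences of norms of differences.\<close>

lemma frechet_metric_imp_fnormed_space:
  assumes d: "frechet_metric d"
  shows "fnormed_space (\<lambda>x. d x 0)"
proof -
  have ms: "Metric_space UNIV d"
    using d by (simp add: frechet_metric_def)
  interpret Metric_space UNIV d
    by (rule ms)
  note diff = frechet_metric_diff[OF d]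
  have lim: "limitin mtopology X z sequentially \<longleftrightarrow> (\<lambda>k. d (X k - z) 0) \<longlonglongrightarrow> 0" for X z
    by (simp add: limitin_metric_dist_null diff[symmetric])
  show ?thesis
  proof
    fix x y :: 'a
    show "d 0 0 = 0" "0 \<le> d x 0"
      by simp_all
    show "x = 0" if "d x 0 = 0"
      using that by simp
    show "d (- x) 0 = d x 0"
      using diff[of 0 x] commute[of 0 x] by simp
    show "d (x + y) 0 \<le> d x 0 + d y 0"
      using triangle[of "x + y" y 0] diff[of "x + y" y] by simp
  next
    fix a :: "nat \<Rightarrow> real" and \<alpha> X and z :: 'a
    assume a: "a \<longlonglongrightarrow> \<alpha>" and X: "(\<lambda>k. d (X k - z) 0) \<longlonglongrightarrow> 0"
    have "continuous_map (prod_topology euclideanreal mtopology) mtopology (\<lambda>(a, x). a *\<^sub>R x)"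
      using d by (simp add: frechet_metric_def)
    moreover have "limitin (prod_topology euclideanreal mtopology) (\<lambda>k. (a k, X k)) (\<alpha>, z) sequentially"
      using a X by (simp add: limitin_pairwise o_def lim)
    ultimately have "limitin mtopology ((\<lambda>(a, x). a *\<^sub>R x) \<circ> (\<lambda>k. (a k, X k))) ((\<lambda>(a, x). a *\<^sub>R x) (\<alpha>, z)) sequentially"
      by (rule continuous_map_limit)
    then show "(\<lambda>k. d (a k *\<^sub>R X k - \<alpha> *\<^sub>R z) 0) \<longlonglongrightarrow> 0"
      by (simp add: o_def lim)
  next
    fix \<epsilon> :: real assume \<epsilon>: "\<epsilon> > 0"
    have "openin mtopology (mball 0 \<epsilon>)" "0 \<in> mball 0 \<epsilon>"
      using \<epsilon> by auto
    moreover have "\<forall>U. openin mtopology U \<and> 0 \<in> U \<longrightarrow>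
        (\<exists>V. openin mtopology V \<and> 0 \<in> V \<and> convex V \<and> V \<subseteq> U)"
      using d by (simp add: frechet_metric_def)
    ultimately obtain V where V: "openin mtopology V" "0 \<in> V" "convex V" "V \<subseteq> mball 0 \<epsilon>"
      by blast
    then obtain \<rho> where \<rho>: "\<rho> > 0" "mball 0 \<rho> \<subseteq> V"
      by (meson openin_mtopology)
    \<comment> \<open>A convex neighbourhood between the two balls contains the hull of the smaller
      one.\<close>
    have "convex hull {x. d x 0 < \<rho>} \<subseteq> V"
      using \<rho>(2) V(3) by (intro hull_minimal) (auto simp: commute[of _ 0])
    also have "\<dots> \<subseteq> {x. d x 0 < \<epsilon>}"
      using V(4) by (auto simp: commute[of _ 0])
    finally show "\<exists>\<rho>>0. convex hull {x. d x 0 < \<rho>} \<subseteq> {x. d x 0 < \<epsilon>}"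
      using \<rho>(1) by blast
  next
    fix X :: "nat \<Rightarrow> 'a"
    assume cau: "\<And>\<epsilon>. \<epsilon> > 0 \<Longrightarrow> \<exists>K. \<forall>m\<ge>K. \<forall>n\<ge>K. d (X m - X n) 0 < \<epsilon>"
    have "MCauchy X"
      unfolding MCauchy_def using cau by (simp add: diff[symmetric])
    then obtain z where "limitin mtopology X z sequentially"
      using d by (auto simp: frechet_metric_def mcomplete_def)
    then show "\<exists>z. (\<lambda>k. d (X k - z) 0) \<longlonglongrightarrow> 0"
      by (auto simp: lim)
  qed
qed

theorem theorem5:
  fixes d :: "'a::real_vector \<Rightarrow> 'a \<Rightarrow> real" and C :: "'a set"
  assumes "frechet_metric d"
    and "convex C"
    and "\<not> separable_space (subtopology (Metric_space.mtopology UNIV d) C)"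
  shows "LFAP (subtopology (Metric_space.mtopology UNIV d) C)"
proof -
  have ms: "Metric_space UNIV d"
    using assms(1) by (simp add: frechet_metric_def)
  \<comment> \<open>The subspace topology on \<open>C\<close> becomes the topology of the restricted
    metric, so that balls and metric continuity are at hand.\<close>
  interpret Submetric UNIV d C
    by (intro Submetric.intro Submetric_axioms.intro ms) simp
  interpret F: fnormed_space "\<lambda>x. d x 0"
    by (rule frechet_metric_imp_fnormed_space[OF assms(1)])
  note diff = frechet_metric_diff[OF assms(1)]
  obtain \<epsilon> A where A: "\<epsilon> > 0" "A \<subseteq> C" "uncountable A" "\<And>x y. x \<in> A \<Longrightarrow> y \<in> A \<Longrightarrow> x \<noteq> y \<Longrightarrow> \<epsilon> \<le> d x y"
  proof -
    have "\<not> separable_space sub.mtopology"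
      using assms(3) by (simp add: mtopology_submetric)
    then show ?thesis
      using sub.nonseparable_imp_uncountable_separated that by blast
  qed
  have "LFAP sub.mtopology"
    unfolding LFAP_def sub.topspace_mtopology
  proof (intro allI impI)
    fix \<U> assume \<U>: "(\<forall>U\<in>\<U>. openin sub.mtopology U) \<and> \<Union>\<U> = C"
    have opn: "\<exists>\<rho>>0. \<forall>y\<in>C. d (y - x) 0 < \<rho> \<longrightarrow> y \<in> U" if U: "U \<in> \<U>" "x \<in> U" "x \<in> C" for U x
    proof -
      obtain \<rho> where \<rho>: "\<rho> > 0" "sub.mball x \<rho> \<subseteq> U"
        using \<U> U sub.openin_mtopology[of U] by auto
      have "y \<in> sub.mball x \<rho>" if "y \<in> C" "d (y - x) 0 < \<rho>" for y
        using that U(3) diff[of y x] commute[of x y] by simp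
      then show ?thesis
        using \<rho> by blast
    qed
    have sep: "\<epsilon> \<le> d (a - a') 0" if "a \<in> A" "a' \<in> A" "a \<noteq> a'" for a a'
      using A(4)[OF that] by (simp add: diff[of a a'])
    have cover: "\<exists>U\<in>\<U>. x \<in> U" if "x \<in> C" for x
      using \<U> that by blast
    obtain f :: "nat \<Rightarrow> 'a \<Rightarrow> 'a" where fC: "\<And>n x. x \<in> C \<Longrightarrow> f n x \<in> C"
      and fcont: "\<And>n X z. range X \<subseteq> C \<Longrightarrow> z \<in> C \<Longrightarrow> F.cvg X z \<Longrightarrow> F.cvg (\<lambda>k. f n (X k)) (f n z)"
      and fnear: "\<And>n x. x \<in> C \<Longrightarrow> \<exists>U\<in>\<U>. x \<in> U \<and> f n x \<in> U"
      and ffin: "\<And>w. w \<in> C \<Longrightarrow> \<exists>\<rho>>0. finite {n. \<exists>x\<in>C. d (f n x - w) 0 < \<rho>}"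
      by (rule F.convex_locally_finite_approximation[OF assms(2) A(2,3,1) sep cover opn], assumption+)
        (rule that)
    have "continuous_map sub.mtopology sub.mtopology (f n)" for n
      unfolding sub.metric_continuous_map[OF sub.Metric_space_axioms]
    proof (intro conjI ballI allI impI)
      show "f n ` C \<subseteq> C"
        using fC by blast
      fix z \<epsilon> assume z: "z \<in> C" and "(0::real) < \<epsilon>"
      have "(\<lambda>k. d (f n (X k) - f n z) 0) \<longlonglongrightarrow> 0" if "\<And>k. X k \<in> C" "F.cvg X z" for X
        using fcont[of X z n] that z unfolding F.cvg_def by blast
      then obtain \<rho> where "\<rho> > 0" "\<And>x. x \<in> C \<Longrightarrow> d (x - z) 0 < \<rho> \<Longrightarrow> d (f n x - f n z) 0 < \<epsilon>"
        using F.sequential_small[of C z "\<lambda>x. d (f n x - f n z) 0" 0 \<epsilon>] \<open>0 < \<epsilon>\<close> by blast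
      then show "\<exists>\<delta>>0. \<forall>x. x \<in> C \<and> d z x < \<delta> \<longrightarrow> d (f n z) (f n x) < \<epsilon>"
        by (intro exI[of _ \<rho>]) (simp add: diff[symmetric] commute[of z] commute[of "f n z"])
    qed
    moreover have "\<exists>V. openin sub.mtopology V \<and> w \<in> V \<and> finite {n. f n ` C \<inter> V \<noteq> {}}" if w: "w \<in> C" for w
    proof -
      obtain \<rho> where \<rho>: "\<rho> > 0" "finite {n. \<exists>x\<in>C. d (f n x - w) 0 < \<rho>}"
        using ffin w by blast
      have "{n. f n ` C \<inter> sub.mball w \<rho> \<noteq> {}} \<subseteq> {n. \<exists>x\<in>C. d (f n x - w) 0 < \<rho>}"
        by (auto simp: diff[symmetric] commute[of w])
      then have "finite {n. f n ` C \<inter> sub.mball w \<rho> \<noteq> {}}"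
        using \<rho>(2) finite_subset by blast
      then show ?thesis
        using w \<rho>(1) by (intro exI[of _ "sub.mball w \<rho>"]) auto
    qed
    ultimately show "\<exists>f :: nat \<Rightarrow> 'a \<Rightarrow> 'a. (\<forall>n. continuous_map sub.mtopology sub.mtopology (f n)) \<and>
        (\<forall>n. \<forall>x\<in>C. \<exists>U\<in>\<U>. x \<in> U \<and> f n x \<in> U) \<and>
        (\<forall>x\<in>C. \<exists>V. openin sub.mtopology V \<and> x \<in> V \<and> finite {n. f n ` C \<inter> V \<noteq> {}})"
      using fnear by (intro exI[of _ f]) blast
  qed
  then show ?thesis
    by (simp add: mtopology_submetric)
qed

end
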